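(* Let $(G,K)$ be a compact Gelfand pair, let $X$ be a non-empty set, and let $f:G\times X^2\to\mathbb{C}$. The following are equivalent: (i) $f\in\mathcal P^\sharp_K(G,X^2)$; (ii) $f$ has a series representation $$f(x,u,v)=\sum_{\varphi\in Z}B(\varphi)(u,v)\varphi(x),\qquad x\in G,\ (u,v)\in X^2,$$ where each $B(\varphi)$ is a positive definite kernel on $X$ and $\sum_{\varphi\in Z}B(\varphi)(u,u)<\infty$ for each $u\in X$. Moreover, for $f\in\mathcal P^\sharp_K(G,X^2)$ one has $$B(\varphi)(u,v)=\delta(\varphi)\int_G f(x,u,v)\overline{\varphi(x)}\,d\omega_G(x),\qquad (u,v)\in X^2.$$
   Context: A kernel $k:Y^2\to\mathbb{C}$ on a set $Y$ is positive definite if $\sum_{j,k=1}^n k(y_j,y_k)c_j\overline{c_k}\ge0$ for all $n$, $y_j\in Y$, $c_j\in\mathbb{C}$. For a group $H$, a continuous $g:H\to\mathbb{C}$ is positive definite if the kernel $(x,y)\mapsto g(x^{-1}y)$ is. Let $G$ be a compact group, $K$ a closed subgroup; $g$ on $G$ is bi-invariant with respect to $K$ if $g(kxl)=g(x)$ for $k,l\in K$. $(G,K)$ is a compact Gelfand pair if the continuous bi-$K$-invariant functions on $G$ form a commutative algebra under convolution $f*g(x)=\int_G f(y)g(y^{-1}x)\,d\omega_G(y)$, with $\omega_G$ Haar measure normalized by $\omega_G(G)=1$ ($\omega_K$ likewise on $K$). A spherical function is a continuous $\varphi:G\to\mathbb{C}$ with $\int_K\varphi(xky)\,d\omega_K(k)=\varphi(x)\varphi(y)$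 for all $x,y$ and $\varphi(e_G)=1$; $Z$ is the set of positive definite spherical functions. For $\varphi\in Z$, $\delta(\varphi)$ is the dimension of the span of $\{x\mapsto\varphi(g^{-1}x):g\in G\}$. $\mathcal P^\sharp_K(G,X^2)$ is the set of $f:G\times X^2\to\mathbb{C}$ such that $f$ is bi-invariant with respect to $K$ in the first variable, $f(\cdot,u,v)$ is continuous on $G$ for each $(u,v)\in X^2$, and the kernel $((x,u),(y,v))\mapsto f(x^{-1}y,u,v)$ on $G\times X$ is positive definite. *)

theory Defs
  imports "HOL-Analysis.Analysis" "HOL-Library.Function_Algebras"
begin

definition compact_group ::
  "('g::t2_space \<Rightarrow> 'g \<Rightarrow> 'g) \<Rightarrow> ('g \<Rightarrow> 'g) \<Rightarrow> 'g \<Rightarrow> bool" where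
  "compact_group gm gi e \<longleftrightarrow>
     (\<forall>x y z. gm (gm x y) z = gm x (gm y z)) \<and>
     (\<forall>x. gm e x = x) \<and> (\<forall>x. gm x e = x) \<and>
     (\<forall>x. gm (gi x) x = e) \<and> (\<forall>x. gm x (gi x) = e) \<and>
     continuous_on UNIV (\<lambda>p::'g \<times> 'g. gm (fst p) (snd p)) \<and>
     continuous_on UNIV gi \<and>
     compact (UNIV :: 'g set)"

definition haar_measure ::
  "('g::topological_space \<Rightarrow> 'g \<Rightarrow> 'g) \<Rightarrow> 'g measure \<Rightarrow> bool" where
  "haar_measure gm \<omega> \<longleftrightarrow>
     sets \<omega> = sets borel \<and> emeasure \<omega> (space \<omega>) = 1 \<and>
     (\<forall>g. distr \<omega> \<omega> (gm g) = \<omega>)"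

definition closed_subgroup ::
  "('g::topological_space \<Rightarrow> 'g \<Rightarrow> 'g) \<Rightarrow> ('g \<Rightarrow> 'g) \<Rightarrow> 'g \<Rightarrow> 'g set \<Rightarrow> bool" where
  "closed_subgroup gm gi e K \<longleftrightarrow>
     closed K \<and> e \<in> K \<and> (\<forall>k\<in>K. \<forall>l\<in>K. gm k l \<in> K) \<and> (\<forall>k\<in>K. gi k \<in> K)"

definition subgroup_haar_measure ::
  "('g::topological_space \<Rightarrow> 'g \<Rightarrow> 'g) \<Rightarrow> 'g set \<Rightarrow> 'g measure \<Rightarrow> bool" where
  "subgroup_haar_measure gm K \<omega>K \<longleftrightarrow>
     sets \<omega>K = sets borel \<and> emeasure \<omega>K (space \<omega>K) = 1 \<and> emeasure \<omega>K K = 1 \<and>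
     (\<forall>k\<in>K. distr \<omega>K \<omega>K (gm k) = \<omega>K)"

definition bi_invariant ::
  "('g \<Rightarrow> 'g \<Rightarrow> 'g) \<Rightarrow> 'g set \<Rightarrow> ('g \<Rightarrow> 'a) \<Rightarrow> bool" where
  "bi_invariant gm K g \<longleftrightarrow> (\<forall>k\<in>K. \<forall>l\<in>K. \<forall>x. g (gm (gm k x) l) = g x)"

definition convolution ::
  "('g \<Rightarrow> 'g \<Rightarrow> 'g) \<Rightarrow> ('g \<Rightarrow> 'g) \<Rightarrow> 'g measure \<Rightarrow> ('g \<Rightarrow> complex) \<Rightarrow> ('g \<Rightarrow> complex)
     \<Rightarrow> 'g \<Rightarrow> complex" where
  "convolution gm gi \<omega> f g x = (LINT y|\<omega>. f y * g (gm (gi y) x))"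

definition gelfand_pair ::
  "('g::topological_space \<Rightarrow> 'g \<Rightarrow> 'g) \<Rightarrow> ('g \<Rightarrow> 'g) \<Rightarrow> 'g measure \<Rightarrow> 'g set \<Rightarrow> bool" where
  "gelfand_pair gm gi \<omega> K \<longleftrightarrow>
     (\<forall>f g :: 'g \<Rightarrow> complex.
        continuous_on UNIV f \<and> bi_invariant gm K f \<and>
        continuous_on UNIV g \<and> bi_invariant gm K g \<longrightarrow>
        convolution gm gi \<omega> f g = convolution gm gi \<omega> g f)"

definition pd_kernel :: "('a \<Rightarrow> 'a \<Rightarrow> complex) \<Rightarrow> bool" where
  "pd_kernel k \<longleftrightarrow>
     (\<forall>(n::nat) (y::nat \<Rightarrow> 'a) (c::nat \<Rightarrow> complex).
        (\<Sum>j<n. \<Sum>l<n. k (y j) (y l) * c j * cnj (c l)) \<ge> 0)"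

definition pd_function ::
  "('g::topological_space \<Rightarrow> 'g \<Rightarrow> 'g) \<Rightarrow> ('g \<Rightarrow> 'g) \<Rightarrow> ('g \<Rightarrow> complex) \<Rightarrow> bool" where
  "pd_function gm gi g \<longleftrightarrow>
     continuous_on UNIV g \<and> pd_kernel (\<lambda>x y. g (gm (gi x) y))"

definition spherical ::
  "('g::topological_space \<Rightarrow> 'g \<Rightarrow> 'g) \<Rightarrow> 'g \<Rightarrow> 'g measure \<Rightarrow> ('g \<Rightarrow> complex) \<Rightarrow> bool" where
  "spherical gm e \<omega>K \<phi> \<longleftrightarrow>
     continuous_on UNIV \<phi> \<and> \<phi> e = 1 \<and>
     (\<forall>x y. (LINT k|\<omega>K. \<phi> (gm (gm x k) y)) = \<phi> x * \<phi> y)"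

definition pd_spherical ::
  "('g::topological_space \<Rightarrow> 'g \<Rightarrow> 'g) \<Rightarrow> ('g \<Rightarrow> 'g) \<Rightarrow> 'g \<Rightarrow> 'g measure
     \<Rightarrow> ('g \<Rightarrow> complex) set" where
  "pd_spherical gm gi e \<omega>K = {\<phi>. spherical gm e \<omega>K \<phi> \<and> pd_function gm gi \<phi>}"

definition delta ::
  "('g \<Rightarrow> 'g \<Rightarrow> 'g) \<Rightarrow> ('g \<Rightarrow> 'g) \<Rightarrow> ('g \<Rightarrow> complex) \<Rightarrow> nat" where
  "delta gm gi \<phi> =
     vector_space.dim (\<lambda>(c::complex) (h::'g \<Rightarrow> complex) x. c * h x)
       {(\<lambda>x. \<phi> (gm (gi g) x)) | g. True}"

definition P_sharp ::
  "('g::topological_space \<Rightarrow> 'g \<Rightarrow> 'g) \<Rightarrow> ('g \<Rightarrow> 'g) \<Rightarrow> 'g set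
     \<Rightarrow> ('g \<Rightarrow> 'x \<Rightarrow> 'x \<Rightarrow> complex) set" where
  "P_sharp gm gi K =
     {f. (\<forall>u v. bi_invariant gm K (\<lambda>x. f x u v)) \<and>
         (\<forall>u v. continuous_on UNIV (\<lambda>x. f x u v)) \<and>
         pd_kernel (\<lambda>(x, u) (y, v). f (gm (gi x) y) u v)}"

definition series_rep ::
  "('g \<Rightarrow> complex) set \<Rightarrow> (('g \<Rightarrow> complex) \<Rightarrow> 'x \<Rightarrow> 'x \<Rightarrow> complex)
     \<Rightarrow> ('g \<Rightarrow> 'x \<Rightarrow> 'x \<Rightarrow> complex) \<Rightarrow> bool" where
  "series_rep Z B f \<longleftrightarrow>
     (\<forall>\<phi>\<in>Z. pd_kernel (B \<phi>)) \<and>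
     (\<forall>u. (\<lambda>\<phi>. B \<phi> u u) summable_on Z) \<and>
     (\<forall>x u v. ((\<lambda>\<phi>. B \<phi> u v * \<phi> x) has_sum f x u v) Z)"

end

theory Submission
  imports Defs "HOL-Probability.Giry_Monad"
begin

text \<open>The continuous \<open>K\<close>-bi-invariant functions form a commutative convolution algebra with
  involution. For a self-adjoint \<open>h \<noteq> 0\<close> in it, the normalised even powers of \<open>h\<close> converge
  uniformly to a self-adjoint idempotent, and idempotents have norm at least \<open>1\<close>, so below
  every idempotent there is a minimal one. A minimal idempotent \<open>p\<close> satisfies
  \<open>p \<star> a \<in> \<complex> p\<close> for all \<open>a\<close>, which makes \<open>p / p(e)\<close> a positive definite spherical function.
  Hence a bi-invariant continuous function orthogonal to all of \<open>Z\<close> vanishes. For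
  \<open>f \<in> P\<^sup>\<sharp>\<^sub>K(G, X\<^sup>2)\<close> the Fourier coefficients \<open>B(\<phi>)\<close> are positive definite kernels
  by the integrated form of positive definiteness, their diagonals are summable by a Bessel inequality, so the
  series converges uniformly, and completeness identifies its sum with \<open>f\<close>. Finally
  \<open>\<delta>(\<phi>) = 1 / \<integral> |\<phi>|\<^sup>2\<close>, because \<open>\<phi>(z\<^sup>-\<^sup>1 x) / \<integral> |\<phi>|\<^sup>2\<close> is the reproducing kernel of the
  span of the translates.\<close>

section \<open>Integration of continuous functions on compact spaces\<close>

text \<open>The spectral argument stays with continuous functions: no L2 completion, no
  representations, no compact operators. What makes this possible is that a convolution is bounded
  pointwise by the L2 norms of its factors. A sequence in the algebra that is Cauchy in L2 thus
  becomes uniformly Cauchy after one more convolution, and its limit is again continuous and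
  bi-invariant. The same bound makes the norm submultiplicative. Commutativity keeps the
  self-adjoint parts of \<open>p \<star> a\<close> below \<open>p\<close>, and it makes distinct
  elements of \<open>Z\<close> orthogonal. Fourier coefficients are formed with the factor
  \<open>1 / nrm2 \<phi>\<close>; that this factor is a dimension is a separate statement about a
  single \<open>\<phi>\<close>, proved without the expansion.\<close>

definition borel_prob :: "'a::topological_space measure \<Rightarrow> bool" where
  "borel_prob M \<longleftrightarrow> sets M = sets borel \<and> prob_space M"

lemma borel_prob_sets: "borel_prob M \<Longrightarrow> sets M = sets borel"
  by (simp add: borel_prob_def)

lemma borel_prob_space: "borel_prob M \<Longrightarrow> space M = UNIV"
  using sets_eq_imp_space_eq[of M borel] by (simp add: borel_prob_def)

lemma borel_prob_finite: "borel_prob M \<Longrightarrow> finite_measure M"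
  by (simp add: borel_prob_def prob_space_def)

text \<open>Point masses are covered so that positive definiteness can later be tested against a
  combination of a point mass at \<open>e\<close> and Haar measure.\<close>

lemma borel_prob_return: "borel_prob (return borel x)"
  by (simp add: borel_prob_def prob_space_return)

lemma borel_prob_measurable:
  fixes f :: "'a::topological_space \<Rightarrow> complex"
  assumes "borel_prob M" "f \<in> borel_measurable borel"
  shows "f \<in> borel_measurable M"
  using assms measurable_cong_sets[OF borel_prob_sets[OF assms(1)] refl] by blast

lemma continuous_measurable:
  fixes f :: "'a::topological_space \<Rightarrow> complex"
  assumes "borel_prob M" "continuous_on UNIV f"
  shows "f \<in> borel_measurable M"
  using assms borel_prob_measurable borel_measurable_continuous_onI by blast

lemma continuous_bounded:
  fixes f :: "'a::topological_space \<Rightarrow> complex"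
  assumes "compact (UNIV :: 'a set)" "continuous_on UNIV f"
  obtains C where "C > 0" "\<And>x. norm (f x) \<le> C"
proof -
  have "bounded (range f)"
    using assms compact_continuous_image compact_imp_bounded by blast
  then obtain C where "C > 0" "\<forall>y\<in>range f. norm y \<le> C"
    unfolding bounded_pos by blast
  then show thesis using that by auto
qed

lemma bounded_integrable:
  fixes f :: "'a::topological_space \<Rightarrow> complex"
  assumes "borel_prob M" "f \<in> borel_measurable borel" "\<And>x. norm (f x) \<le> C"
  shows "integrable M f"
  using assms finite_measure.integrable_const_bound[of M f C] borel_prob_finite
    borel_prob_measurable by blast

lemma continuous_integrable:
  fixes f :: "'a::topological_space \<Rightarrow> complex"
  assumes "compact (UNIV :: 'a set)" "borel_prob M" "continuous_on UNIV f"
  shows "integrable M f"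
  by (rule continuous_bounded[OF assms(1,3)])
    (rule bounded_integrable[OF assms(2) borel_measurable_continuous_onI[OF assms(3)]])

lemma norm_integral_le:
  fixes f :: "'a::topological_space \<Rightarrow> complex"
  assumes "borel_prob M" "\<And>x. norm (f x) \<le> C"
  shows "norm (integral\<^sup>L M f) \<le> C"
proof (cases "integrable M f")
  case True
  interpret prob_space M using assms by (simp add: borel_prob_def)
  have "norm (integral\<^sup>L M f) \<le> (LINT x|M. norm (f x))"
    by (rule integral_norm_bound)
  also have "\<dots> \<le> (LINT x|M. C)"
    by (rule integral_mono) (use True assms in auto)
  finally show ?thesis by (simp add: prob_space)
next
  case False
  \<comment> \<open>The integral of a non-integrable function is 0 by convention, and
    \<open>C\<close> is nonnegative because it bounds a norm.\<close>
  then show ?thesis using order_trans[OF norm_ge_zero assms(2)]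
    by (simp add: not_integrable_integral_eq)
qed

lemma norm_integral_diff_le:
  fixes f g :: "'a::topological_space \<Rightarrow> complex"
  assumes "borel_prob M" "integrable M f" "integrable M g" "\<And>x. norm (f x - g x) \<le> C"
  shows "norm (integral\<^sup>L M f - integral\<^sup>L M g) \<le> C"
  using norm_integral_le[OF assms(1), of "\<lambda>x. f x - g x" C] assms by simp

text \<open>A continuous function of two variables is, up to \<open>\<epsilon>\<close>, unchanged when a variable is
  rounded to one of finitely many points. Product \<open>\<sigma>\<close>-algebras are avoided on purpose: without
  second countability a continuous function on the product need not be measurable for them.\<close>

lemma finite_subcover:
  assumes "compact (UNIV :: 'a::topological_space set)" "\<And>t. open (U t)" "(UNIV :: 'a set) \<subseteq> (\<Union>t. U t)"
  shows "\<exists>T. finite T \<and> UNIV \<subseteq> \<Union>(U ` T)"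
  by (rule compactE_image[OF assms(1), of UNIV U]) (use assms(2,3) in auto)

text \<open>The choice of a covering set is made measurable by priority: points of the newest set go
  to its index and all others keep their old value, so each fibre arises from open sets by finite
  unions and differences.\<close>

lemma rounding_on_finite_cover:
  fixes U :: "'a::topological_space \<Rightarrow> 'a set"
  assumes "finite T" "\<And>t. open (U t)"
  shows "\<exists>r. (\<forall>z\<in>\<Union>(U ` T). r z \<in> T \<and> z \<in> U (r z)) \<and> (\<forall>t. r -` {t} \<inter> \<Union>(U ` T) \<in> sets borel)"
  using assms(1)
proof induction
  case (insert t0 T)
  from insert.IH obtain r where r: "\<forall>z\<in>\<Union>(U ` T). r z \<in> T \<and> z \<in> U (r z)"
      "\<forall>t. r -` {t} \<inter> \<Union>(U ` T) \<in> sets borel"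
    by (elim exE conjE)
  define r' where "r' z = (if z \<in> U t0 then t0 else r z)" for z
  have "r' -` {t} \<inter> \<Union>(U ` insert t0 T) \<in> sets borel" for t
  proof -
    have "r' -` {t} \<inter> \<Union>(U ` insert t0 T)
        = (if t = t0 then U t0 else {}) \<union> (r -` {t} \<inter> \<Union>(U ` T) - U t0)"
    proof (rule set_eqI)
      show "z \<in> r' -` {t} \<inter> \<Union>(U ` insert t0 T) \<longleftrightarrow>
          z \<in> (if t = t0 then U t0 else {}) \<union> (r -` {t} \<inter> \<Union>(U ` T) - U t0)" for z
        by (cases "z \<in> U t0"; cases "t = t0") (simp_all add: r'_def)
    qed
    also have "\<dots> \<in> sets borel"
      by (intro sets.Un sets.Diff r(2)[rule_format]) (simp_all add: assms(2) borel_open)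
    finally show ?thesis .
  qed
  moreover have "\<forall>z\<in>\<Union>(U ` insert t0 T). r' z \<in> insert t0 T \<and> z \<in> U (r' z)"
  proof
    show "r' z \<in> insert t0 T \<and> z \<in> U (r' z)" if "z \<in> \<Union>(U ` insert t0 T)" for z
      using that bspec[OF r(1), of z] by (cases "z \<in> U t0") (simp_all add: r'_def)
  qed
  ultimately show ?case by (intro exI[of _ r'] conjI allI)
qed simp

text \<open>A single \<open>r\<close> must serve all \<open>H i\<close> and both variables, because
  the double sums of a positive definite kernel need the same sample points in every entry.
  Compactness of the other factor makes closeness uniform in \<open>y\<close>, and finiteness of
  \<open>I\<close> allows the neighbourhoods to be intersected.\<close>

lemma fine_rounding:
  fixes H :: "'i \<Rightarrow> 'a::topological_space \<Rightarrow> 'a \<Rightarrow> complex"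
  assumes "compact (UNIV :: 'a set)" "finite I" "\<epsilon> > 0"
    and "\<And>i. i \<in> I \<Longrightarrow> continuous_on UNIV (\<lambda>p. H i (fst p) (snd p))"
  obtains r :: "'a \<Rightarrow> 'a" where "finite (range r)" "\<And>t. r -` {t} \<in> sets borel"
    "\<And>i z y. i \<in> I \<Longrightarrow> norm (H i z y - H i (r z) y) \<le> \<epsilon>"
    "\<And>i z y. i \<in> I \<Longrightarrow> norm (H i y z - H i y (r z)) \<le> \<epsilon>"
proof -
  have near: "\<forall>\<^sub>F z in nhds x. \<forall>y. norm (F z y - F x y) \<le> \<epsilon>"
    if "continuous_on UNIV (\<lambda>p. F (fst p) (snd p))" for F :: "'a \<Rightarrow> 'a \<Rightarrow> complex" and x
    unfolding eventually_nhds
    by (rule continuous_on_prod_compactE[of UNIV UNIV "\<lambda>p. F (fst p) (snd p)" x \<epsilon>])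
      (use that assms in \<open>auto simp: dist_norm\<close>)
  have swap: "continuous_on UNIV (\<lambda>p. H i (snd p) (fst p))" if "i \<in> I" for i
    using continuous_on_compose2[OF assms(4)[OF that] continuous_on_swap subset_UNIV, of UNIV]
    by (simp add: prod.swap_def)
  define P where "P x z \<longleftrightarrow> (\<forall>i\<in>I. (\<forall>y. norm (H i z y - H i x y) \<le> \<epsilon>)
      \<and> (\<forall>y. norm (H i y z - H i y x) \<le> \<epsilon>))" for x z
  have "\<forall>\<^sub>F z in nhds x. P x z" for x
    unfolding P_def
    by (intro eventually_ball_finite assms(2) ballI eventually_conj near[OF assms(4)]
        near[of "\<lambda>x y. H _ y x", OF swap])
  then have "\<exists>S. open S \<and> x \<in> S \<and> (\<forall>z\<in>S. P x z)" for x
    unfolding eventually_nhds .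
  then obtain U where open_U: "\<And>x. open (U x)" and U: "\<And>x. x \<in> U x" "\<And>x z. z \<in> U x \<Longrightarrow> P x z"
    by metis
  have "UNIV \<subseteq> (\<Union>x. U x)" using U(1) by blast
  then obtain T where T: "finite T" "UNIV \<subseteq> \<Union>(U ` T)"
    using finite_subcover[OF assms(1), of U] open_U by blast
  then have cover: "\<Union>(U ` T) = UNIV" by blast
  obtain r where r: "\<forall>z\<in>\<Union>(U ` T). r z \<in> T \<and> z \<in> U (r z)"
      "\<forall>t. r -` {t} \<inter> \<Union>(U ` T) \<in> sets borel"
    using rounding_on_finite_cover[of T U, OF T(1) open_U] by (elim exE conjE)
  have rT: "r z \<in> T" and rP: "P (r z) z" for z
    using bspec[OF r(1)[unfolded cover], of z] U(2) by simp_all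
  show thesis
  proof
    show "finite (range r)" by (rule finite_subset[OF _ T(1)]) (use rT in auto)
    show "r -` {t} \<in> sets borel" for t using spec[OF r(2), of t] cover by simp
  qed (use rP in \<open>simp_all add: P_def\<close>)
qed

lemma rounded_decomposition:
  fixes g :: "'a \<Rightarrow> complex"
  assumes "finite (range r)"
  shows "g (r z) = (\<Sum>t\<in>range r. of_real (indicator (r -` {t}) z) * g t)"
proof -
  have "(\<Sum>t\<in>range r. of_real (indicator (r -` {t}) z) * g t)
      = (\<Sum>t\<in>range r. if t = r z then g t else 0)"
    by (intro sum.cong) (auto simp: indicator_def)
  then show ?thesis using assms by simp
qed

lemma integral_rounded:
  fixes g :: "'a::topological_space \<Rightarrow> complex"
  assumes M: "borel_prob M" and r: "finite (range r)" "\<And>t. r -` {t} \<in> sets borel"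
  shows "integrable M (\<lambda>z. g (r z))"
    and "(LINT z|M. g (r z)) = (\<Sum>t\<in>range r. of_real (measure M (r -` {t})) * g t)"
proof -
  interpret prob_space M using M by (simp add: borel_prob_def)
  note spM = borel_prob_space[OF M]
  have *: "integrable M (\<lambda>z. of_real (indicator (r -` {t}) z) * g t)" for t
    using r M by (auto intro!: integrable_mult_left integrable_of_real integrable_real_indicator
        simp: borel_prob_sets emeasure_eq_measure)
  show "integrable M (\<lambda>z. g (r z))"
    unfolding rounded_decomposition[OF r(1), of g] using * by auto
  have "(LINT z|M. of_real (indicator (r -` {t}) z) * g t) = of_real (measure M (r -` {t})) * g t" for t
    using spM by simp
  then show "(LINT z|M. g (r z)) = (\<Sum>t\<in>range r. of_real (measure M (r -` {t})) * g t)"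
    unfolding rounded_decomposition[OF r(1), of g]
    using Bochner_Integration.integral_sum[of "range r" M, OF *] spM by simp
qed

section \<open>Parametric integrals and Fubini for continuous functions\<close>

lemma continuous_parametric_integral:
  fixes H :: "'a::topological_space \<Rightarrow> 'b::topological_space \<Rightarrow> complex"
  assumes "compact (UNIV :: 'b set)" "borel_prob N"
    and H: "continuous_on UNIV (\<lambda>p. H (fst p) (snd p))"
  shows "continuous_on UNIV (\<lambda>x. LINT y|N. H x y)"
  unfolding continuous_on_topological
proof (intro ballI allI impI)
  fix x :: 'a and B :: "complex set"
  assume "open B" "(LINT y|N. H x y) \<in> B"
  then obtain \<epsilon> where \<epsilon>: "\<epsilon> > 0" "\<And>w. dist w (LINT y|N. H x y) < \<epsilon> \<Longrightarrow> w \<in> B"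
    using open_dist by metis
  have int: "integrable N (H z)" for z
    using continuous_integrable[OF assms(1,2)] continuous_on_compose2[OF H, of UNIV "\<lambda>y. (z, y)"]
    by (simp add: continuous_on_Pair)
  obtain X where X: "x \<in> X" "open X" "\<forall>z\<in>X. \<forall>y. dist (H z y) (H x y) \<le> \<epsilon> / 2"
    by (rule continuous_on_prod_compactE[of UNIV UNIV "\<lambda>p. H (fst p) (snd p)" x "\<epsilon> / 2"])
      (use assms \<epsilon> in auto)
  have "dist (LINT y|N. H z y) (LINT y|N. H x y) < \<epsilon>" if "z \<in> X" for z
    using norm_integral_diff_le[OF assms(2) int int, of z x "\<epsilon> / 2"] X that \<epsilon>(1)
    by (force simp: dist_norm)
  then show "\<exists>A. open A \<and> x \<in> A \<and> (\<forall>y\<in>UNIV. y \<in> A \<longrightarrow> (LINT ya|N. H y ya) \<in> B)"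
    using X \<epsilon> by blast
qed

lemma continuous_on_section:
  fixes H :: "'a::topological_space \<Rightarrow> 'b::topological_space \<Rightarrow> 'c::topological_space"
  assumes "continuous_on UNIV (\<lambda>p. H (fst p) (snd p))"
  shows "continuous_on UNIV (H x)" "continuous_on UNIV (\<lambda>x. H x y)"
  using continuous_on_compose2[OF assms, of UNIV "\<lambda>y. (x, y)"]
    continuous_on_compose2[OF assms, of UNIV "\<lambda>x. (x, y)"]
  by (simp_all add: continuous_on_Pair)

lemma continuous_on_swap_args:
  assumes "continuous_on UNIV (\<lambda>p. H (fst p) (snd p))"
  shows "continuous_on UNIV (\<lambda>p. H (snd p) (fst p))"
  using continuous_on_compose2[OF assms continuous_on_swap subset_UNIV, of UNIV]
  by (simp add: prod.swap_def)

lemma eq_if_norm_diff_le: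
  fixes a b :: complex
  assumes "\<And>\<epsilon>. \<epsilon> > 0 \<Longrightarrow> norm (a - b) \<le> c * \<epsilon>" "c > 0"
  shows "a = b"
proof (rule ccontr)
  assume "a \<noteq> b"
  then have "norm (a - b) \<le> c * (norm (a - b) / (2 * c))"
    using assms by (intro assms(1)) auto
  then show False using \<open>a \<noteq> b\<close> assms(2) by (simp add: field_simps)
qed

text \<open>Rounding the first variable turns the integral over it into a finite sum, which commutes
  with the other integral; each iterated integral moves by at most
  \<open>\<epsilon>\<close>.\<close>

lemma fubini_continuous:
  fixes H :: "'a::topological_space \<Rightarrow> 'a \<Rightarrow> complex"
  assumes U: "compact (UNIV :: 'a set)" and M: "borel_prob M" and N: "borel_prob N"
    and H: "continuous_on UNIV (\<lambda>p. H (fst p) (snd p))"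
  shows "(LINT x|M. LINT y|N. H x y) = (LINT y|N. LINT x|M. H x y)"
proof (rule eq_if_norm_diff_le)
  fix \<epsilon> :: real assume \<epsilon>: "\<epsilon> > 0"
  note sec = continuous_on_section[OF H]
  note intH = continuous_integrable[OF U N sec(1)] continuous_integrable[OF U M sec(2)]
  note H' = continuous_on_swap_args[OF H]
  obtain r where r: "finite (range r)" "\<And>t. r -` {t} \<in> sets borel"
      "\<And>z y. norm (H z y - H (r z) y) \<le> \<epsilon>"
    by (rule fine_rounding[OF U, of "{()}" \<epsilon> "\<lambda>_. H"]) (use \<epsilon> H in auto)
  note ir = integral_rounded[OF M r(1,2)]
  have "norm ((LINT x|M. LINT y|N. H x y) - (LINT x|M. LINT y|N. H (r x) y)) \<le> \<epsilon>"
    by (intro norm_integral_diff_le[OF M] continuous_integrable[OF U M]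
        continuous_parametric_integral[OF U N H] ir(1)[where g="\<lambda>x. LINT y|N. H x y"]
        norm_integral_diff_le[OF N] intH r(3))
  moreover have "norm ((LINT y|N. LINT x|M. H x y) - (LINT y|N. LINT x|M. H (r x) y)) \<le> \<epsilon>"
  proof (rule norm_integral_diff_le[OF N])
    show "integrable N (\<lambda>y. LINT x|M. H x y)"
      using continuous_integrable[OF U N continuous_parametric_integral[OF U M, of "\<lambda>y x. H x y"]] H' by simp
    show "integrable N (\<lambda>y. LINT x|M. H (r x) y)"
      unfolding ir(2)[of "\<lambda>x. H x _"] by (auto intro!: integrable_sum intH)
    show "norm ((LINT x|M. H x y) - (LINT x|M. H (r x) y)) \<le> \<epsilon>" for y
      by (rule norm_integral_diff_le[OF M intH(2) ir(1)[of "\<lambda>x. H x y"] r(3)])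
  qed
  moreover have "(LINT x|M. LINT y|N. H (r x) y) = (LINT y|N. LINT x|M. H (r x) y)"
    unfolding ir(2)[of "\<lambda>x. H x _"] ir(2)[of "\<lambda>x. LINT y|N. H x y"]
    by (subst Bochner_Integration.integral_sum) (auto intro!: intH)
  ultimately show "norm ((LINT x|M. LINT y|N. H x y) - (LINT y|N. LINT x|M. H x y)) \<le> 2 * \<epsilon>"
    using norm_diff_triangle_le[of _ "LINT y|N. LINT x|M. H (r x) y" \<epsilon> _ \<epsilon>]
    by (simp add: norm_minus_commute)
qed auto

section \<open>Positive definite kernels\<close>

text \<open>Discretised integrals are indexed by pairs of a position and a sample point, hence the
  general finite index set.\<close>

lemma pd_kernel_finite_sum:
  assumes "pd_kernel k" "finite (S :: 'i set)"
  shows "(\<Sum>p\<in>S. \<Sum>q\<in>S. k (y p) (y q) * c p * cnj (c q)) \<ge> 0"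
proof -
  obtain h where h: "bij_betw h {..<card S} S"
    using ex_bij_betw_nat_finite[OF assms(2)] by (auto simp: atLeast0LessThan)
  have "(\<Sum>p\<in>S. \<Sum>q\<in>S. k (y p) (y q) * c p * cnj (c q))
      = (\<Sum>j<card S. \<Sum>l<card S. k (y (h j)) (y (h l)) * c (h j) * cnj (c (h l)))"
    by (simp add: sum.reindex_bij_betw[OF h, symmetric])
  also have "\<dots> \<ge> 0"
    using assms(1)[unfolded pd_kernel_def, rule_format, where n="card S" and y="\<lambda>j. y (h j)" and c="\<lambda>j. c (h j)"] .
  finally show ?thesis .
qed

lemma complex_nonneg_approx:
  fixes z :: complex
  assumes "\<And>\<epsilon>. \<epsilon> > 0 \<Longrightarrow> \<exists>w\<ge>0. norm (z - w) \<le> c * \<epsilon>" "c > 0"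
  shows "z \<ge> 0"
proof -
  have *: "\<exists>w::complex\<ge>0. norm (z - w) \<le> \<epsilon>" if "\<epsilon> > 0" for \<epsilon>
    using assms(1)[of "\<epsilon> / c"] assms(2) that by simp
  have "\<bar>Im z\<bar> \<le> \<epsilon> \<and> Re z \<ge> - \<epsilon>" if \<epsilon>: "\<epsilon> > 0" for \<epsilon>
  proof -
    obtain w where w: "w \<ge> 0" "norm (z - w) \<le> \<epsilon>" using *[OF \<epsilon>] by blast
    then show ?thesis
      using abs_Re_le_cmod[of "z - w"] abs_Im_le_cmod[of "z - w"] by (auto simp: less_eq_complex_def)
  qed
  then have "Im z = 0" "Re z \<ge> 0"
    using field_le_epsilon[of "\<bar>Im z\<bar>" 0] field_le_epsilon[of "- Re z" 0] by (force, force)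
  then show ?thesis by (simp add: less_eq_complex_def)
qed

text \<open>Each index has its own measure, so that point masses and Haar measure can be mixed.
  After rounding all entries with one \<open>r\<close>, the expression is the form of
  \<open>k\<close> at the points \<open>(s, u j)\<close> with coefficients
  \<open>m j s * a j s\<close>, and nonnegativity survives the limit.\<close>

lemma pd_kernel_integral:
  fixes k :: "'a::topological_space \<times> 'x \<Rightarrow> 'a \<times> 'x \<Rightarrow> complex" and n :: nat
  assumes U: "compact (UNIV :: 'a set)" and k: "pd_kernel k"
    and cont: "\<And>u v. continuous_on UNIV (\<lambda>p. k (fst p, u) (snd p, v))"
    and M: "\<And>j. borel_prob (M j)" and a: "\<And>j. continuous_on UNIV (a j)"
  shows "(\<Sum>j<n. \<Sum>l<n. LINT x|M j. LINT y|M l. k (x, u j) (y, u l) * a j x * cnj (a l y)) \<ge> 0"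
proof (rule complex_nonneg_approx)
  fix \<epsilon> :: real assume \<epsilon>: "\<epsilon> > 0"
  define H where "H i x y = (case i of (j, l) \<Rightarrow> k (x, u j) (y, u l) * a j x * cnj (a l y))"
    for i :: "nat \<times> nat" and x y
  have cH: "continuous_on UNIV (\<lambda>p. H i (fst p) (snd p))" for i
    unfolding H_def case_prod_beta
    by (intro continuous_intros cont continuous_on_compose2[OF a]) auto
  obtain r :: "'a \<Rightarrow> 'a" where r: "finite (range r)" "\<And>t. r -` {t} \<in> sets borel"
      "\<And>i z y. i \<in> {..<n} \<times> {..<n} \<Longrightarrow> norm (H i z y - H i (r z) y) \<le> \<epsilon>"
      "\<And>i z y. i \<in> {..<n} \<times> {..<n} \<Longrightarrow> norm (H i y z - H i y (r z)) \<le> \<epsilon>"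
    by (rule fine_rounding[OF U _ \<epsilon>, of "{..<n} \<times> {..<n}" H]) (use cH in auto)
  define m where "m j t = measure (M j) (r -` {t})" for j t
  note ir = integral_rounded[OF M r(1,2), folded m_def]
  note sec = continuous_on_section[OF cH]
  define D where "D i = (\<Sum>s\<in>range r. \<Sum>t\<in>range r. of_real (m (fst i) s) * (of_real (m (snd i) t) * H i s t))"
    for i
  have *: "norm ((LINT x|M j. LINT y|M l. H (j, l) x y) - D (j, l)) \<le> 2 * \<epsilon>" if "j < n" "l < n" for j l
  proof -
    let ?i = "(j, l)"
    have i: "?i \<in> {..<n} \<times> {..<n}" using that by simp
    have "norm ((LINT x|M j. LINT y|M l. H ?i x y) - (LINT x|M j. LINT y|M l. H ?i (r x) y)) \<le> \<epsilon>"
      by (intro norm_integral_diff_le[OF M] continuous_integrable[OF U M]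
          continuous_parametric_integral[OF U M cH] ir(1)[where g="\<lambda>x. LINT y|M l. H ?i x y"]
          sec r(3) i)
    moreover have "norm ((LINT x|M j. LINT y|M l. H ?i (r x) y)
        - (LINT x|M j. LINT y|M l. H ?i (r x) (r y))) \<le> \<epsilon>"
      by (intro norm_integral_diff_le[OF M] continuous_integrable[OF U M]
          ir(1)[where g="\<lambda>x. LINT y|M l. H ?i x y"] ir(1)[where g="\<lambda>x. LINT y|M l. H ?i x (r y)"]
          ir(1)[where g="H ?i _"] sec r(4) i)
    moreover have "(LINT x|M j. LINT y|M l. H ?i (r x) (r y)) = D ?i"
      using ir(2)[of j "\<lambda>x. LINT y|M l. H ?i x (r y)"] ir(2)[of l "H ?i _"]
      by (simp add: D_def sum_distrib_left)
    ultimately show ?thesis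
      unfolding mult_2 by (intro norm_diff_triangle_le[of _ _ \<epsilon> _ \<epsilon>]) simp_all
  qed
  let ?S = "{..<n} \<times> range r"
  let ?c = "\<lambda>(j, s). of_real (m j s) * a j s"
  have prod_sum: "(\<Sum>p\<in>?S. F p) = (\<Sum>j<n. \<Sum>s\<in>range r. F (j, s))" for F :: "_ \<Rightarrow> complex"
    by (simp add: sum.cartesian_product)
  have "(\<Sum>j<n. \<Sum>l<n. D (j, l)) = (\<Sum>j<n. \<Sum>s\<in>range r. \<Sum>l<n. \<Sum>t\<in>range r.
      of_real (m j s) * (of_real (m l t) * H (j, l) s t))"
    unfolding D_def fst_conv snd_conv by (intro sum.cong refl sum.swap)
  also have "\<dots> = (\<Sum>p\<in>?S. \<Sum>q\<in>?S. k (snd p, u (fst p)) (snd q, u (fst q)) * ?c p * cnj (?c q))"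
    unfolding prod_sum by (intro sum.cong refl) (simp add: H_def mult_ac)
  also have "\<dots> \<ge> 0"
    using pd_kernel_finite_sum[OF k, of ?S "\<lambda>p. (snd p, u (fst p))" ?c] r(1) by simp
  finally have nonneg: "(\<Sum>j<n. \<Sum>l<n. D (j, l)) \<ge> 0" .
  have "norm ((\<Sum>j<n. \<Sum>l<n. LINT x|M j. LINT y|M l. H (j, l) x y) - (\<Sum>j<n. \<Sum>l<n. D (j, l)))
      \<le> (\<Sum>j<n. \<Sum>l<n. 2 * \<epsilon>)"
    unfolding sum_subtractf[symmetric] by (intro sum_norm_le *) simp_all
  \<comment> \<open>The summand 1 keeps the constant positive when \<open>n = 0\<close>, as
    \<open>complex_nonneg_approx\<close> demands.\<close>
  also have "\<dots> \<le> (2 * real n * real n + 1) * \<epsilon>"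
    using \<epsilon> by (simp add: algebra_simps)
  finally have "norm ((\<Sum>j<n. \<Sum>l<n. LINT x|M j. LINT y|M l. H (j, l) x y) - (\<Sum>j<n. \<Sum>l<n. D (j, l)))
      \<le> (2 * real n * real n + 1) * \<epsilon>" .
  then show "\<exists>w\<ge>0. norm ((\<Sum>j<n. \<Sum>l<n. LINT x|M j. LINT y|M l.
      k (x, u j) (y, u l) * a j x * cnj (a l y)) - w) \<le> (2 * real n * real n + 1) * \<epsilon>"
    using nonneg unfolding H_def by auto
next
  show "0 < 2 * real n * real n + 1" by (intro add_nonneg_pos) auto
qed

section \<open>Haar measure on a compact group\<close>

locale compact_grp =
  fixes gm :: "'g::t2_space \<Rightarrow> 'g \<Rightarrow> 'g" (infixl "\<cdot>" 70) and gi :: "'g \<Rightarrow> 'g" and e :: 'g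
  assumes compact_group: "compact_group gm gi e"
begin

lemma assoc: "x \<cdot> y \<cdot> z = x \<cdot> (y \<cdot> z)"
  and unit [simp]: "e \<cdot> x = x" "x \<cdot> e = x"
  and inv [simp]: "gi x \<cdot> x = e" "x \<cdot> gi x = e"
  and compact_UNIV: "compact (UNIV :: 'g set)"
  using compact_group unfolding compact_group_def by blast+

lemma inv_cancel [simp]: "gi x \<cdot> (x \<cdot> y) = y" "x \<cdot> (gi x \<cdot> y) = y"
  by (simp_all flip: assoc)

lemma inv_unique: "x \<cdot> y = e \<Longrightarrow> gi x = y"
  using inv_cancel(1)[of x y] by simp

lemma inv_inv [simp]: "gi (gi x) = x"
  by (rule inv_unique) simp

lemma inv_mult [simp]: "gi (x \<cdot> y) = gi y \<cdot> gi x"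
  by (rule inv_unique) (simp add: assoc)

lemma inv_unit [simp]: "gi e = e"
  by (rule inv_unique) simp

lemma continuous_mult [continuous_intros]:
  "continuous_on S f \<Longrightarrow> continuous_on S g \<Longrightarrow> continuous_on S (\<lambda>x. f x \<cdot> g x)"
  using continuous_on_compose2[of UNIV "\<lambda>p. fst p \<cdot> snd p" S "\<lambda>x. (f x, g x)"] compact_group
  by (auto simp: compact_group_def continuous_on_Pair)

lemma continuous_inv [continuous_intros]:
  "continuous_on S f \<Longrightarrow> continuous_on S (\<lambda>x. gi (f x))"
  using continuous_on_compose2[of UNIV gi S f] compact_group by (auto simp: compact_group_def)

definition cont :: "('g \<Rightarrow> complex) \<Rightarrow> bool" where
  "cont a \<longleftrightarrow> continuous_on UNIV a"

lemma cont_compose: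
  "cont a \<Longrightarrow> continuous_on S f \<Longrightarrow> continuous_on S (\<lambda>x. a (f x))"
  using continuous_on_compose2[of UNIV a S f] by (auto simp: cont_def)

lemma integrable_cont: "borel_prob M \<Longrightarrow> continuous_on UNIV f \<Longrightarrow> integrable M f"
  for f :: "'g \<Rightarrow> complex"
  by (rule continuous_integrable[OF compact_UNIV])

lemmas fubini = fubini_continuous[OF compact_UNIV]
lemmas continuous_integral = continuous_parametric_integral[OF compact_UNIV]

context
  fixes K :: "'g set" and \<mu> :: "'g measure"
  assumes K: "closed_subgroup gm gi e K" and \<mu>: "subgroup_haar_measure gm K \<mu>"
begin

lemma subgroup_haar_borel_prob: "borel_prob \<mu>"
  using \<mu> by (auto simp: subgroup_haar_measure_def borel_prob_def intro: prob_spaceI)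

text \<open>The measure of the subgroup lives on the whole group with full mass on \<open>K\<close>;
  this is what lets identities valid only on \<open>K\<close> pass under the integral.\<close>

lemma subgroup_haar_cong:
  fixes f g :: "'g \<Rightarrow> complex"
  assumes "continuous_on UNIV f" "continuous_on UNIV g" "\<And>k. k \<in> K \<Longrightarrow> f k = g k"
  shows "integral\<^sup>L \<mu> f = integral\<^sup>L \<mu> g"
proof (rule integral_cong_AE)
  interpret prob_space \<mu> using subgroup_haar_borel_prob by (simp add: borel_prob_def)
  have "K \<in> sets \<mu>" "prob K = 1"
    using K \<mu> by (auto simp: closed_subgroup_def subgroup_haar_measure_def measure_def)
  then have "AE k in \<mu>. k \<in> K" by (simp add: prob_eq_1)
  then show "AE k in \<mu>. f k = g k" using assms(3) by auto
qed (use assms continuous_measurable[OF subgroup_haar_borel_prob] in auto)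

lemma subgroup_haar_left:
  assumes "k \<in> K" "continuous_on UNIV f"
  shows "(LINT x|\<mu>. f (k \<cdot> x)) = (LINT x|\<mu>. f x :: complex)"
proof -
  have "gm k \<in> measurable \<mu> \<mu>"
    using measurable_cong_sets[OF borel_prob_sets borel_prob_sets, OF subgroup_haar_borel_prob subgroup_haar_borel_prob]
    by (auto intro!: borel_measurable_continuous_onI continuous_intros)
  then have "(LINT x|distr \<mu> \<mu> (gm k). f x) = (LINT x|\<mu>. f (k \<cdot> x))"
    by (rule integral_distr) (rule continuous_measurable[OF subgroup_haar_borel_prob assms(2)])
  then show ?thesis using \<mu> assms(1) by (simp add: subgroup_haar_measure_def)
qed

text \<open>Only left invariance is given. Integrate \<open>f (gi x \<cdot> y)\<close> over both
  variables: with \<open>y\<close> inside, translation by \<open>gi x\<close> gives the integral of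
  \<open>f\<close>; with \<open>x\<close> inside, translation by \<open>gi y\<close> gives the
  integral of \<open>f (gi x)\<close>. Fubini equates the two, and right invariance follows.\<close>

lemma subgroup_haar_inv:
  assumes f: "continuous_on UNIV f"
  shows "(LINT x|\<mu>. f (gi x)) = (LINT x|\<mu>. f x :: complex)"
proof -
  note P = subgroup_haar_borel_prob
  have gi: "gi k \<in> K" if "k \<in> K" for k using K that by (auto simp: closed_subgroup_def)
  have c: "continuous_on UNIV (\<lambda>p. f (gi (fst p) \<cdot> snd p))"
    by (intro continuous_on_compose2[OF f] continuous_intros) auto
  have 1: "(LINT x|\<mu>. LINT y|\<mu>. f (gi x \<cdot> y)) = (LINT x|\<mu>. LINT y|\<mu>. f y)"
    by (intro subgroup_haar_cong continuous_integral[OF P c] continuous_on_const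
        subgroup_haar_left gi f)
  have "(LINT y|\<mu>. LINT x|\<mu>. f (gi x \<cdot> y)) = (LINT y|\<mu>. LINT x|\<mu>. f (gi x))"
  proof (rule subgroup_haar_cong[OF _ continuous_on_const])
    show "continuous_on UNIV (\<lambda>y. LINT x|\<mu>. f (gi x \<cdot> y))"
      using continuous_integral[OF P, of "\<lambda>y x. f (gi x \<cdot> y)"] continuous_on_swap_args[OF c] by simp
    show "(LINT x|\<mu>. f (gi x \<cdot> y)) = (LINT x|\<mu>. f (gi x))" if "y \<in> K" for y
      using subgroup_haar_left[OF gi[OF that], of "\<lambda>x. f (gi x)"] f
      by (simp add: continuous_intros continuous_on_compose2[OF f])
  qed
  moreover have "(LINT x|\<mu>. c) = c" for c :: complex
    using \<mu> borel_prob_space[OF P] by (simp add: subgroup_haar_measure_def measure_def)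
  ultimately show ?thesis using 1 fubini[OF P P c] by simp
qed

lemma subgroup_haar_right:
  assumes "k \<in> K" and f: "continuous_on UNIV f"
  shows "(LINT x|\<mu>. f (x \<cdot> k)) = (LINT x|\<mu>. f x :: complex)"
proof -
  have gi: "gi k \<in> K" using K assms(1) by (auto simp: closed_subgroup_def)
  have c: "continuous_on UNIV (\<lambda>x. f (gi x))"
    by (intro continuous_on_compose2[OF f] continuous_intros) auto
  have "(LINT x|\<mu>. f (x \<cdot> k)) = (LINT x|\<mu>. f (gi x \<cdot> k))"
    by (intro subgroup_haar_inv[symmetric] continuous_on_compose2[OF f] continuous_intros) auto
  also have "\<dots> = (LINT x|\<mu>. f (gi x))"
    using subgroup_haar_left[OF gi c] by simp
  also have "\<dots> = (LINT x|\<mu>. f x)" by (rule subgroup_haar_inv[OF f])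
  finally show ?thesis .
qed

end

end

locale compact_haar = compact_grp gm gi e
  for gm :: "'g::t2_space \<Rightarrow> 'g \<Rightarrow> 'g" (infixl "\<cdot>" 70) and gi e +
  fixes \<omega> :: "'g measure"
  assumes haar: "haar_measure gm \<omega>"
begin

text \<open>Regarding the group as a subgroup of itself makes the preceding results available for
  its own Haar measure.\<close>

lemma closed_subgroup_UNIV: "closed_subgroup gm gi e UNIV"
  by (simp add: closed_subgroup_def)

lemma subgroup_haar_UNIV: "subgroup_haar_measure gm UNIV \<omega>"
  using haar sets_eq_imp_space_eq[of \<omega> borel]
  by (simp add: haar_measure_def subgroup_haar_measure_def)

lemmas
  borel_prob = subgroup_haar_borel_prob[OF closed_subgroup_UNIV subgroup_haar_UNIV] and
  haar_left = subgroup_haar_left[OF closed_subgroup_UNIV subgroup_haar_UNIV UNIV_I] and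
  haar_inv = subgroup_haar_inv[OF closed_subgroup_UNIV subgroup_haar_UNIV] and
  haar_right = subgroup_haar_right[OF closed_subgroup_UNIV subgroup_haar_UNIV UNIV_I]

lemmas integrable = integrable_cont[OF borel_prob]

sublocale prob_space \<omega>
  using borel_prob by (simp add: borel_prob_def)

text \<open>Finitely many translates of \<open>U\<close> cover the compact group; if
  \<open>U\<close> were null, so would be the whole space, which has measure 1.\<close>

lemma open_measure_pos:
  assumes "open U" "U \<noteq> {}"
  shows "measure \<omega> U > 0"
proof (rule ccontr)
  assume "\<not> measure \<omega> U > 0"
  then have 0: "emeasure \<omega> U = 0" by (simp add: emeasure_eq_measure zero_less_measure_iff)
  obtain x where x: "x \<in> U" using assms by blast
  have meas: "gm g \<in> measurable \<omega> \<omega>" for g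
    using measurable_cong_sets[OF borel_prob_sets borel_prob_sets, OF borel_prob borel_prob]
    by (auto intro!: borel_measurable_continuous_onI continuous_intros)
  have op: "open (gm g -` U)" for g
    using assms(1) continuous_on_open_vimage[of UNIV "gm g"] by (simp add: continuous_intros)
  have null: "emeasure \<omega> (gm g -` U) = 0" for g
    using emeasure_distr[OF meas, of U g] haar 0 assms(1) borel_prob_space[OF borel_prob]
    by (simp add: haar_measure_def)
  have "y \<in> gm (x \<cdot> gi y) -` U" for y using x by (simp add: assoc)
  then have "UNIV \<subseteq> (\<Union>g. gm g -` U)" by blast
  then obtain T where T: "finite T" "UNIV \<subseteq> (\<Union>g\<in>T. gm g -` U)"
    using finite_subcover[OF compact_UNIV, of "\<lambda>g. gm g -` U"] op by blast
  have "(\<Union>g\<in>T. gm g -` U) \<in> null_sets \<omega>"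
    using T(1) null op borel_prob_sets[OF borel_prob]
    by (intro null_sets_UN' countable_finite) (auto simp: null_sets_def)
  moreover have "(\<Union>g\<in>T. gm g -` U) = space \<omega>" using T(2) borel_prob_space[OF borel_prob] by auto
  ultimately show False using emeasure_space_1 by (simp add: null_sets_def)
qed

section \<open>Inner product and norm on continuous functions\<close>

definition inner :: "('g \<Rightarrow> complex) \<Rightarrow> ('g \<Rightarrow> complex) \<Rightarrow> complex" where
  "inner a b = (LINT x|\<omega>. a x * cnj (b x))"

definition nrm2 :: "('g \<Rightarrow> complex) \<Rightarrow> real" where
  "nrm2 a = (LINT x|\<omega>. (norm (a x))\<^sup>2)"

lemma integrable_real: "continuous_on UNIV f \<Longrightarrow> integrable \<omega> (f :: 'g \<Rightarrow> real)"
  using integrable_Re[OF integrable, of "\<lambda>x. complex_of_real (f x)"] by (simp add: continuous_on_of_real)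

lemma inner_self: "inner a a = of_real (nrm2 a)"
  unfolding inner_def nrm2_def by (simp flip: complex_norm_square integral_of_real of_real_power)

lemma nrm2_nonneg: "nrm2 a \<ge> 0"
  unfolding nrm2_def by simp

lemma nrm2_eq_0:
  assumes a: "cont a" and "nrm2 a = 0"
  shows "a x = 0"
proof (rule ccontr)
  assume ax: "a x \<noteq> 0"
  define U where "U = {y. norm (a y) > norm (a x) / 2}"
  have U: "open U" unfolding U_def using a by (intro open_Collect_less continuous_intros cont_compose[OF a]) 
  have "x \<in> U" using ax by (simp add: U_def)
  then have pos: "measure \<omega> U > 0" using open_measure_pos U by blast
  have Um: "U \<in> sets \<omega>" using U borel_prob_sets[OF borel_prob] by simp
  have "measure \<omega> U * (norm (a x) / 2)\<^sup>2 = (LINT y|\<omega>. indicator U y * (norm (a x) / 2)\<^sup>2)"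
    using Um by (simp add: borel_prob_space[OF borel_prob])
  also have "\<dots> \<le> nrm2 a"
    unfolding nrm2_def
  proof (rule integral_mono)
    show "integrable \<omega> (\<lambda>y. indicator U y * (norm (a x) / 2)\<^sup>2 :: real)"
      using Um by (intro integrable_mult_left integrable_real_indicator) (simp_all add: emeasure_eq_measure)
    show "integrable \<omega> (\<lambda>y. (norm (a y))\<^sup>2)"
      using a by (intro integrable_real continuous_intros cont_compose[OF a])
    show "indicator U y * (norm (a x) / 2)\<^sup>2 \<le> (norm (a y))\<^sup>2" for y
      by (auto simp: indicator_def U_def intro: power_mono)
  qed
  finally have "measure \<omega> U * (norm (a x) / 2)\<^sup>2 \<le> 0" using assms by simp
  moreover have "measure \<omega> U * (norm (a x) / 2)\<^sup>2 > 0" using pos ax by simp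
  ultimately show False by simp
qed

lemma inner_cnj: "inner b a = cnj (inner a b)"
  unfolding inner_def using Bochner_Integration.integral_cnj[of \<omega> "\<lambda>x. a x * cnj (b x)"] by (simp add: mult.commute)

lemma inner_add_left: "cont a \<Longrightarrow> cont b \<Longrightarrow> cont c \<Longrightarrow> inner (\<lambda>x. a x + b x) c = inner a c + inner b c"
  unfolding inner_def distrib_right
  by (rule Bochner_Integration.integral_add) (auto intro!: integrable continuous_intros simp: cont_def)

lemma inner_diff_left: "cont a \<Longrightarrow> cont b \<Longrightarrow> cont c \<Longrightarrow> inner (\<lambda>x. a x - b x) c = inner a c - inner b c"
  unfolding inner_def left_diff_distrib
  by (rule Bochner_Integration.integral_diff) (auto intro!: integrable continuous_intros simp: cont_def)

lemma inner_scale_left: "inner (\<lambda>x. r * a x) c = r * inner a c"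
  unfolding inner_def by (simp add: mult.assoc)

lemma inner_sum_left:
  "(\<And>i. i \<in> I \<Longrightarrow> cont (a i)) \<Longrightarrow> cont c \<Longrightarrow> inner (\<lambda>x. \<Sum>i\<in>I. a i x) c = (\<Sum>i\<in>I. inner (a i) c)"
  unfolding inner_def sum_distrib_right
  by (rule Bochner_Integration.integral_sum) (auto intro!: integrable continuous_intros simp: cont_def)

lemma inner_diff_right: "cont a \<Longrightarrow> cont b \<Longrightarrow> cont c \<Longrightarrow> inner c (\<lambda>x. a x - b x) = inner c a - inner c b"
  by (subst (1 2 3) inner_cnj) (simp add: inner_diff_left)

lemma inner_scale_right: "inner c (\<lambda>x. r * a x) = cnj r * inner c a"
  by (subst (1 2) inner_cnj) (simp add: inner_scale_left)

lemma inner_sum_right: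
  "(\<And>i. i \<in> I \<Longrightarrow> cont (a i)) \<Longrightarrow> cont c \<Longrightarrow> inner c (\<lambda>x. \<Sum>i\<in>I. a i x) = (\<Sum>i\<in>I. inner c (a i))"
  by (subst (1 2) inner_cnj) (simp add: inner_sum_left)

lemma nrm2_diff:
  assumes "cont a" "cont b"
  shows "nrm2 (\<lambda>x. a x - b x) = nrm2 a - 2 * Re (inner a b) + nrm2 b"
proof -
  have c: "cont (\<lambda>x. a x - b x)" using assms by (auto simp: cont_def intro!: continuous_intros)
  have "complex_of_real (nrm2 (\<lambda>x. a x - b x)) = inner a a - inner a b - (cnj (inner a b) - inner b b)"
    unfolding inner_self[symmetric]
    using assms c by (simp add: inner_diff_left inner_diff_right inner_cnj[of b a])
  then have "Re (complex_of_real (nrm2 (\<lambda>x. a x - b x))) = Re (inner a a - inner a b - (cnj (inner a b) - inner b b))"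
    by (rule arg_cong)
  then show ?thesis by (simp add: inner_self)
qed

lemma nrm2_scale: "nrm2 (\<lambda>x. r * a x) = (norm r)\<^sup>2 * nrm2 a"
  unfolding nrm2_def by (simp add: norm_mult power_mult_distrib)

lemma cauchy_schwarz:
  assumes "cont a" "cont b"
  shows "(norm (inner a b))\<^sup>2 \<le> nrm2 a * nrm2 b"
proof (cases "nrm2 b = 0")
  case True
  then have "b = (\<lambda>x. 0)" using nrm2_eq_0[OF assms(2)] by auto
  then show ?thesis by (simp add: inner_def nrm2_def)
next
  case False
  then have pos: "nrm2 b > 0" using nrm2_nonneg[of b] by simp
  define t where "t = inner a b / of_real (nrm2 b)"
  have c: "cont (\<lambda>x. t * b x)" using assms by (auto simp: cont_def intro!: continuous_intros)
  have "0 \<le> nrm2 (\<lambda>x. a x - t * b x)" by (rule nrm2_nonneg)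
  also have "\<dots> = nrm2 a - 2 * Re (cnj t * inner a b) + (norm t)\<^sup>2 * nrm2 b"
    by (simp add: nrm2_diff[OF assms(1) c] nrm2_scale inner_scale_right)
  also have "cnj t * inner a b = of_real ((norm (inner a b))\<^sup>2 / nrm2 b)"
    unfolding t_def of_real_divide complex_norm_square by simp
  also have "(norm t)\<^sup>2 * nrm2 b = (norm (inner a b))\<^sup>2 / nrm2 b"
    using pos by (simp add: t_def norm_divide power_divide power2_eq_square)
  finally show ?thesis using pos by (simp add: field_simps)
qed

lemma nrm2_le_sup:
  assumes "cont a" "\<And>x. norm (a x) \<le> C"
  shows "nrm2 a \<le> C\<^sup>2"
proof -
  have "nrm2 a \<le> (LINT x|\<omega>. C\<^sup>2)"
    unfolding nrm2_def
    using assms by (intro integral_mono integrable_real continuous_intros power_mono cont_compose[OF assms(1)]) auto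
  then show ?thesis by (simp add: prob_space)
qed

end

section \<open>The convolution algebra\<close>

text \<open>Log-convexity makes the ratios \<open>s (Suc n) / s n\<close> increase and
  submultiplicativity bounds them by \<open>s 0\<close>; \<open>L\<close> is their limit. The
  quotient \<open>s (n + k + 1) / s n\<close> is a product of \<open>k + 1\<close> ratios, so it
  tends to \<open>L ^ Suc k\<close>, and it is at most \<open>s k\<close>. Ratios below
  \<open>L\<close> make \<open>s n / L ^ Suc n\<close> decrease. The exponent is
  \<open>Suc n\<close> because \<open>s n\<close> will belong to the power
  \<open>n + 1\<close>.\<close>

lemma logconvex_submultiplicative_growth:
  fixes s :: "nat \<Rightarrow> real"
  assumes pos: "\<And>n. s n > 0" and lc: "\<And>n. (s (Suc n))\<^sup>2 \<le> s n * s (Suc (Suc n))"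
    and sub: "\<And>n k. s (n + k + 1) \<le> s n * s k"
  obtains L where "L > 0" "\<And>k. L ^ Suc k \<le> s k" "convergent (\<lambda>n. s n / L ^ Suc n)"
proof -
  define r where "r n = s (Suc n) / s n" for n
  have r_pos: "r n > 0" for n using pos by (simp add: r_def)
  have r_Suc: "r n \<le> r (Suc n)" for n
    using lc[of n] pos[of n] pos[of "Suc n"] by (simp add: r_def field_simps power2_eq_square)
  have "incseq r" by (rule incseq_SucI) (rule r_Suc)
  moreover have "r n \<le> s 0" for n
    using sub[of n 0] pos[of n] by (simp add: r_def field_simps)
  ultimately obtain L where L: "r \<longlonglongrightarrow> L" "\<And>n. r n \<le> L"
    using incseq_convergent[of r "s 0"] by blast
  have L_pos: "L > 0" using L(2)[of 0] r_pos[of 0] by linarith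
  have quot: "(\<lambda>n. s (n + k + 1) / s n) \<longlonglongrightarrow> L ^ Suc k" for k
  proof (induction k)
    case 0
    then show ?case using L(1) by (simp add: r_def[abs_def])
  next
    case (Suc k)
    have "(\<lambda>n. r (n + Suc k) * (s (n + k + 1) / s n)) \<longlonglongrightarrow> L * L ^ Suc k"
      by (intro tendsto_mult Suc LIMSEQ_ignore_initial_segment L(1))
    moreover have "r (n + Suc k) * (s (n + k + 1) / s n) = s (n + Suc k + 1) / s n" for n
      using pos[of "n + Suc k"] by (simp add: r_def)
    ultimately show ?case by (simp only: power_Suc)
  qed
  have "L ^ Suc k \<le> s k" for k
  proof (rule LIMSEQ_le_const2[OF quot])
    show "\<exists>N. \<forall>n\<ge>N. s (n + k + 1) / s n \<le> s k"
      using sub[of _ k] pos by (auto simp: field_simps)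
  qed
  moreover have "convergent (\<lambda>n. s n / L ^ Suc n)"
  proof -
    have "decseq (\<lambda>n. s n / L ^ Suc n)"
    proof (rule decseq_SucI)
      fix n
      have "s (Suc n) \<le> L * s n" using L(2)[of n] pos[of n] by (simp add: r_def field_simps)
      then show "s (Suc n) / L ^ Suc (Suc n) \<le> s n / L ^ Suc n"
        using L_pos by (simp add: field_simps)
    qed
    moreover have "\<forall>n. 0 \<le> s n / L ^ Suc n" using pos L_pos by (simp add: less_imp_le)
    ultimately show ?thesis
      by (rule decseq_convergent) (auto simp: convergent_def)
  qed
  ultimately show thesis using that L_pos by blast
qed

context compact_haar
begin

abbreviation conv :: "('g \<Rightarrow> complex) \<Rightarrow> ('g \<Rightarrow> complex) \<Rightarrow> 'g \<Rightarrow> complex" (infixl "\<star>" 75) where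
  "a \<star> b \<equiv> convolution gm gi \<omega> a b"

definition star :: "('g \<Rightarrow> complex) \<Rightarrow> 'g \<Rightarrow> complex" where
  "star a x = cnj (a (gi x))"

lemma cont_continuous: "cont a \<Longrightarrow> continuous_on UNIV a"
  by (simp add: cont_def)

lemma cont_const: "cont (\<lambda>x. c)"
  and cont_add: "cont a \<Longrightarrow> cont b \<Longrightarrow> cont (\<lambda>x. a x + b x)"
  and cont_diff: "cont a \<Longrightarrow> cont b \<Longrightarrow> cont (\<lambda>x. a x - b x)"
  and cont_mult: "cont a \<Longrightarrow> cont b \<Longrightarrow> cont (\<lambda>x. a x * b x)"
  and cont_cnj: "cont a \<Longrightarrow> cont (\<lambda>x. cnj (a x))"
  and cont_sum: "(\<And>i. i \<in> I \<Longrightarrow> cont (f i)) \<Longrightarrow> cont (\<lambda>x. \<Sum>i\<in>I. f i x)"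
  unfolding cont_def by (auto intro!: continuous_intros)

lemma cont_left: "cont a \<Longrightarrow> cont (\<lambda>x. a (g \<cdot> x))"
  and cont_right: "cont a \<Longrightarrow> cont (\<lambda>x. a (x \<cdot> g))"
  and cont_inv: "cont a \<Longrightarrow> cont (\<lambda>x. a (gi x))"
  unfolding cont_def
  by (auto simp: cont_def intro!: cont_compose[unfolded cont_def] continuous_intros)

lemma cont_star: "cont a \<Longrightarrow> cont (star a)"
  unfolding star_def[abs_def] by (intro cont_cnj cont_inv)

lemma conv_integrand_continuous:
  "cont a \<Longrightarrow> cont b \<Longrightarrow> continuous_on UNIV (\<lambda>p. a (snd p) * b (gi (snd p) \<cdot> fst p))"
  by (intro continuous_intros cont_compose)

lemma cont_conv:
  assumes "cont a" "cont b"
  shows "cont (a \<star> b)"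
proof -
  have "continuous_on UNIV (\<lambda>x. LINT y|\<omega>. a y * b (gi y \<cdot> x))"
    by (intro continuous_integral[OF borel_prob] conv_integrand_continuous assms)
  then show ?thesis by (simp add: cont_def convolution_def[abs_def])
qed

lemmas cont_intros = cont_const cont_add cont_diff cont_mult cont_cnj cont_sum cont_left cont_right
  cont_inv cont_star cont_conv

lemma integrable_cont': "cont a \<Longrightarrow> integrable \<omega> a"
  by (rule integrable) (rule cont_continuous)

text \<open>Through this form linearity and Cauchy-Schwarz carry over from the inner product to
  convolution.\<close>

lemma conv_eq_inner: "(a \<star> b) x = inner a (\<lambda>y. star b (gi x \<cdot> y))"
  by (simp add: convolution_def inner_def star_def)

lemma conv_star_unit: "(a \<star> star b) e = inner a b"
  by (simp add: convolution_def inner_def star_def)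

lemma star_star [simp]: "star (star a) = a"
  by (simp add: star_def fun_eq_iff)

lemma nrm2_left: "cont a \<Longrightarrow> nrm2 (\<lambda>y. a (x \<cdot> y)) = nrm2 a"
proof -
  assume a: "cont a"
  have "(LINT y|\<omega>. a (x \<cdot> y) * cnj (a (x \<cdot> y))) = (LINT y|\<omega>. a y * cnj (a y))"
    by (rule haar_left[of "\<lambda>y. a y * cnj (a y)"]) (intro cont_continuous cont_intros a)
  then have "complex_of_real (nrm2 (\<lambda>y. a (x \<cdot> y))) = complex_of_real (nrm2 a)"
    by (simp add: inner_def flip: inner_self)
  then show ?thesis by (simp only: of_real_eq_iff)
qed

lemma nrm2_star: "cont a \<Longrightarrow> nrm2 (star a) = nrm2 a"
proof -
  assume a: "cont a"
  have "(LINT y|\<omega>. cnj (a (gi y)) * a (gi y)) = (LINT y|\<omega>. cnj (a y) * a y)"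
    by (rule haar_inv[of "\<lambda>y. cnj (a y) * a y"]) (intro cont_continuous cont_intros a)
  then have "complex_of_real (nrm2 (star a)) = complex_of_real (nrm2 a)"
    by (simp add: inner_def star_def mult.commute flip: inner_self)
  then show ?thesis by (simp only: of_real_eq_iff)
qed

text \<open>Young's inequality from L2 times L2 into the supremum norm. It is the source of every
  uniform estimate in the spectral argument.\<close>

lemma conv_bound:
  assumes "cont a" "cont b"
  shows "(norm ((a \<star> b) x))\<^sup>2 \<le> nrm2 a * nrm2 b"
proof -
  have "(norm ((a \<star> b) x))\<^sup>2 \<le> nrm2 a * nrm2 (\<lambda>y. star b (gi x \<cdot> y))"
    unfolding conv_eq_inner using assms by (intro cauchy_schwarz cont_intros)
  then show ?thesis using assms by (simp add: nrm2_left nrm2_star cont_star)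
qed

lemma conv_bound_sqrt:
  assumes "cont a" "cont b"
  shows "norm ((a \<star> b) x) \<le> sqrt (nrm2 a) * sqrt (nrm2 b)"
  using conv_bound[OF assms, of x] by (simp add: real_le_rsqrt real_sqrt_mult[symmetric])

lemma nrm2_conv_le: "cont a \<Longrightarrow> cont b \<Longrightarrow> nrm2 (a \<star> b) \<le> nrm2 a * nrm2 b"
  using nrm2_le_sup[OF cont_conv conv_bound_sqrt] nrm2_nonneg by (simp add: power_mult_distrib)

lemma conv_assoc:
  assumes "cont a" "cont b" "cont c"
  shows "(a \<star> b) \<star> c = a \<star> (b \<star> c)"
proof
  fix x
  have "((a \<star> b) \<star> c) x = (LINT y|\<omega>. LINT z|\<omega>. a z * b (gi z \<cdot> y) * c (gi y \<cdot> x))"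
    by (simp add: convolution_def)
  also have "\<dots> = (LINT z|\<omega>. LINT y|\<omega>. a z * b (gi z \<cdot> y) * c (gi y \<cdot> x))"
    by (rule fubini[OF borel_prob borel_prob]) (intro continuous_intros cont_compose assms)
  also have "\<dots> = (LINT z|\<omega>. a z * (LINT y|\<omega>. b y * c (gi y \<cdot> (gi z \<cdot> x))))"
  proof (rule Bochner_Integration.integral_cong[OF refl])
    fix z
    have "(LINT y|\<omega>. b (gi z \<cdot> y) * c (gi (gi z \<cdot> y) \<cdot> (gi z \<cdot> x)))
        = (LINT y|\<omega>. b y * c (gi y \<cdot> (gi z \<cdot> x)))"
      by (rule haar_left[of "\<lambda>y. b y * c (gi y \<cdot> (gi z \<cdot> x))"])
        (intro continuous_intros cont_compose assms)
    then show "(LINT y|\<omega>. a z * b (gi z \<cdot> y) * c (gi y \<cdot> x))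
        = a z * (LINT y|\<omega>. b y * c (gi y \<cdot> (gi z \<cdot> x)))"
      by (simp add: assoc mult.assoc)
  qed
  finally show "((a \<star> b) \<star> c) x = (a \<star> (b \<star> c)) x" by (simp add: convolution_def)
qed

lemma star_conv:
  assumes "cont a" "cont b"
  shows "star (a \<star> b) = star b \<star> star a"
proof
  fix x
  have "(star b \<star> star a) x = (LINT y|\<omega>. cnj (a (gi x \<cdot> y)) * cnj (b (gi y)))"
    by (simp add: convolution_def star_def mult.commute)
  also have "\<dots> = (LINT y|\<omega>. cnj (a (gi x \<cdot> (x \<cdot> y))) * cnj (b (gi (x \<cdot> y))))"
    by (rule haar_left[symmetric]) (intro continuous_intros cont_compose assms)
  also have "\<dots> = star (a \<star> b) x"
    by (simp add: convolution_def star_def flip: Bochner_Integration.integral_cnj)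
  finally show "star (a \<star> b) x = (star b \<star> star a) x" by simp
qed

lemma conv_diff_left:
  assumes "cont a" "cont b" "cont c"
  shows "(\<lambda>x. a x - b x) \<star> c = (\<lambda>x. (a \<star> c) x - (b \<star> c) x)"
  unfolding conv_eq_inner[abs_def] using assms by (simp add: inner_diff_left cont_intros)

lemma conv_add_left:
  assumes "cont a" "cont b" "cont c"
  shows "(\<lambda>x. a x + b x) \<star> c = (\<lambda>x. (a \<star> c) x + (b \<star> c) x)"
  unfolding conv_eq_inner[abs_def] using assms by (simp add: inner_add_left cont_intros)

lemma conv_scale_left: "(\<lambda>x. r * a x) \<star> c = (\<lambda>x. r * (a \<star> c) x)"
  unfolding conv_eq_inner[abs_def] by (simp add: inner_scale_left)

lemma conv_sum_left:
  assumes "\<And>i. i \<in> I \<Longrightarrow> cont (a i)" "cont c"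
  shows "(\<lambda>x. \<Sum>i\<in>I. a i x) \<star> c = (\<lambda>x. \<Sum>i\<in>I. (a i \<star> c) x)"
  unfolding conv_eq_inner[abs_def] using assms by (simp add: inner_sum_left cont_intros)

lemma conv_scale_right: "a \<star> (\<lambda>x. r * c x) = (\<lambda>x. r * (a \<star> c) x)"
  by (simp add: convolution_def fun_eq_iff mult.left_commute)

lemma conv_zero_left: "(\<lambda>x. 0) \<star> a = (\<lambda>x. 0)"
  by (simp add: convolution_def fun_eq_iff)

end

section \<open>Bi-invariant functions as a commutative algebra\<close>

locale gelfand = compact_haar gm gi e \<omega>
  for gm :: "'g::t2_space \<Rightarrow> 'g \<Rightarrow> 'g" (infixl "\<cdot>" 70) and gi e \<omega> +
  fixes K :: "'g set" and \<omega>K :: "'g measure"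
  assumes subgroup: "closed_subgroup gm gi e K"
    and haar_K: "subgroup_haar_measure gm K \<omega>K"
    and gelfand_pair: "gelfand_pair gm gi \<omega> K"
begin

lemmas
  borel_prob_K = subgroup_haar_borel_prob[OF subgroup haar_K] and
  haar_K_cong = subgroup_haar_cong[OF subgroup haar_K] and
  haar_K_left = subgroup_haar_left[OF subgroup haar_K] and
  haar_K_right = subgroup_haar_right[OF subgroup haar_K]

lemma unit_K: "e \<in> K" and inv_K: "k \<in> K \<Longrightarrow> gi k \<in> K"
  using subgroup by (auto simp: closed_subgroup_def)

lemma integral_K_const [simp]: "(LINT k|\<omega>K. c) = (c :: complex)"
  using haar_K borel_prob_space[OF borel_prob_K] by (simp add: subgroup_haar_measure_def measure_def)

definition alg :: "('g \<Rightarrow> complex) \<Rightarrow> bool" where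
  "alg a \<longleftrightarrow> cont a \<and> bi_invariant gm K a"

lemma alg_cont: "alg a \<Longrightarrow> cont a" by (simp add: alg_def)

lemma alg_left: "alg a \<Longrightarrow> k \<in> K \<Longrightarrow> a (k \<cdot> x) = a x"
  and alg_right: "alg a \<Longrightarrow> k \<in> K \<Longrightarrow> a (x \<cdot> k) = a x"
  using unit_K unfolding alg_def bi_invariant_def by (metis unit)+

lemma algI:
  assumes "cont a" "\<And>k x. k \<in> K \<Longrightarrow> a (k \<cdot> x) = a x" "\<And>k x. k \<in> K \<Longrightarrow> a (x \<cdot> k) = a x"
  shows "alg a"
  using assms by (simp add: alg_def bi_invariant_def)

lemma alg_diff: "alg a \<Longrightarrow> alg b \<Longrightarrow> alg (\<lambda>x. a x - b x)"
  and alg_add: "alg a \<Longrightarrow> alg b \<Longrightarrow> alg (\<lambda>x. a x + b x)"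
  and alg_scale: "alg a \<Longrightarrow> alg (\<lambda>x. r * a x)"
  by (rule algI; simp add: cont_intros alg_cont alg_left alg_right)+

lemma alg_sum: "(\<And>i. i \<in> I \<Longrightarrow> alg (f i)) \<Longrightarrow> alg (\<lambda>x. \<Sum>i\<in>I. f i x)"
  by (rule algI) (simp_all add: cont_sum alg_cont alg_left alg_right)

lemma alg_star: "alg a \<Longrightarrow> alg (star a)"
  by (rule algI) (simp_all add: cont_star alg_cont, simp_all add: star_def alg_left alg_right inv_K)

lemma alg_conv:
  assumes a: "alg a" and b: "alg b"
  shows "alg (a \<star> b)"
proof (rule algI)
  show "cont (a \<star> b)" by (intro cont_intros alg_cont assms)
  show "(a \<star> b) (x \<cdot> k) = (a \<star> b) x" if "k \<in> K" for k x
    using alg_right[OF b that] by (simp add: convolution_def flip: assoc)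
  show "(a \<star> b) (k \<cdot> x) = (a \<star> b) x" if k: "k \<in> K" for k x
  proof -
    have "(a \<star> b) (k \<cdot> x) = (LINT y|\<omega>. a (k \<cdot> y) * b (gi (k \<cdot> y) \<cdot> (k \<cdot> x)))"
      unfolding convolution_def using alg_cont[OF a] alg_cont[OF b]
      by (intro haar_left[symmetric] continuous_intros cont_compose)
    also have "\<dots> = (a \<star> b) x" using alg_left[OF a k] by (simp add: convolution_def assoc)
    finally show ?thesis .
  qed
qed

lemma alg_comm: "alg a \<Longrightarrow> alg b \<Longrightarrow> a \<star> b = b \<star> a"
  using gelfand_pair by (simp add: gelfand_pair_def alg_def cont_def)

lemmas alg_intros = alg_diff alg_add alg_scale alg_sum alg_star alg_conv

end

section \<open>Minimal idempotents and spherical functions\<close>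

lemma integral_complex_nonneg:
  fixes f :: "'a \<Rightarrow> complex"
  assumes "integrable M f" "\<And>x. f x \<ge> 0"
  shows "integral\<^sup>L M f \<ge> 0"
proof -
  have "Re (integral\<^sup>L M f) \<ge> 0"
    using assms by (simp add: less_eq_complex_def flip: integral_Re)
  moreover have "Im (integral\<^sup>L M f) = 0"
    using assms by (simp add: less_eq_complex_def flip: integral_Im)
  ultimately show ?thesis by (simp add: less_eq_complex_def)
qed

text \<open>The second factor at \<open>gi x \<cdot> y\<close> is the integral over \<open>z\<close>
  of \<open>a (gi x \<cdot> z) * cnj (a (gi y \<cdot> z))\<close>. For fixed \<open>z\<close> this
  is a rank-one kernel, whose factors are absorbed into the coefficients, leaving the form of
  \<open>B\<close> under the integral. It is the case of Schur's product theorem needed for the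
  terms of the series.\<close>

lemma (in compact_haar) pd_kernel_times_conv_star:
  assumes B: "pd_kernel B" and a: "cont a"
  shows "pd_kernel (\<lambda>p q. B (snd p) (snd q) * (a \<star> star a) (gi (fst p) \<cdot> fst q))"
  unfolding pd_kernel_def
proof (intro allI)
  fix n :: nat and w :: "nat \<Rightarrow> 'g \<times> 'a" and c :: "nat \<Rightarrow> complex"
  have conv: "(a \<star> star a) (gi x \<cdot> y) = (LINT z|\<omega>. a (gi x \<cdot> z) * cnj (a (gi y \<cdot> z)))" for x y
  proof -
    have "(LINT z|\<omega>. a (gi x \<cdot> z) * cnj (a (gi y \<cdot> (x \<cdot> (gi x \<cdot> z)))))
        = (LINT z|\<omega>. a z * cnj (a (gi y \<cdot> (x \<cdot> z))))"
      by (rule haar_left) (intro continuous_intros cont_compose a)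
    then show ?thesis by (simp add: convolution_def star_def assoc)
  qed
  have int: "integrable \<omega> (\<lambda>z. a (gi x \<cdot> z) * cnj (a (gi y \<cdot> z)))" for x y
    by (intro integrable continuous_intros cont_compose a)
  have "(\<Sum>j<n. \<Sum>l<n. B (snd (w j)) (snd (w l)) * (a \<star> star a) (gi (fst (w j)) \<cdot> fst (w l)) * c j * cnj (c l))
      = (\<Sum>j<n. \<Sum>l<n. LINT z|\<omega>. B (snd (w j)) (snd (w l)) * c j * cnj (c l)
          * (a (gi (fst (w j)) \<cdot> z) * cnj (a (gi (fst (w l)) \<cdot> z))))"
    by (intro sum.cong refl) (simp add: conv mult_ac)
  also have "\<dots> = (LINT z|\<omega>. (\<Sum>j<n. \<Sum>l<n. B (snd (w j)) (snd (w l)) * c j * cnj (c l)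
          * (a (gi (fst (w j)) \<cdot> z) * cnj (a (gi (fst (w l)) \<cdot> z)))))"
    using int by simp
  also have "\<dots> = (LINT z|\<omega>. (\<Sum>j<n. \<Sum>l<n. B (snd (w j)) (snd (w l))
          * (c j * a (gi (fst (w j)) \<cdot> z)) * cnj (c l * a (gi (fst (w l)) \<cdot> z))))"
    by (simp add: mult_ac)
  also have "\<dots> \<ge> 0"
  proof (rule integral_complex_nonneg)
    show "integrable \<omega> (\<lambda>z. \<Sum>j<n. \<Sum>l<n. B (snd (w j)) (snd (w l))
          * (c j * a (gi (fst (w j)) \<cdot> z)) * cnj (c l * a (gi (fst (w l)) \<cdot> z)))"
      by (intro integrable continuous_intros cont_compose a)
    show "(\<Sum>j<n. \<Sum>l<n. B (snd (w j)) (snd (w l))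
          * (c j * a (gi (fst (w j)) \<cdot> z)) * cnj (c l * a (gi (fst (w l)) \<cdot> z))) \<ge> 0" for z
      using B[unfolded pd_kernel_def, rule_format, where n=n and y="\<lambda>j. snd (w j)"
          and c="\<lambda>j. c j * a (gi (fst (w j)) \<cdot> z)"] .
  qed
  finally show "(\<Sum>j<n. \<Sum>l<n. B (snd (w j)) (snd (w l)) * (a \<star> star a) (gi (fst (w j)) \<cdot> fst (w l)) * c j * cnj (c l)) \<ge> 0" .
qed

lemma pd_kernel_one: "pd_kernel (\<lambda>u v. 1)"
  unfolding pd_kernel_def
proof (intro allI)
  fix n and c :: "nat \<Rightarrow> complex"
  have "(\<Sum>j<n. \<Sum>l<n. 1 * c j * cnj (c l)) = (\<Sum>j<n. c j) * cnj (\<Sum>j<n. c j)"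
    by (simp add: sum_product)
  also have "\<dots> \<ge> 0" by (simp only: complex_norm_square[symmetric]) (simp add: less_eq_complex_def)
  finally show "(\<Sum>j<n. \<Sum>l<n. 1 * c j * cnj (c l)) \<ge> 0" .
qed

lemma pd_kernel_scale:
  assumes k: "pd_kernel k" and r: "r \<ge> 0"
  shows "pd_kernel (\<lambda>x y. of_real r * k x y)"
  unfolding pd_kernel_def
proof (intro allI)
  fix n :: nat and y and c :: "nat \<Rightarrow> complex"
  have "(\<Sum>j<n. \<Sum>l<n. of_real r * k (y j) (y l) * c j * cnj (c l))
      = of_real r * (\<Sum>j<n. \<Sum>l<n. k (y j) (y l) * c j * cnj (c l))"
    by (simp add: sum_distrib_left mult_ac)
  also have "\<dots> \<ge> 0"
    using k[unfolded pd_kernel_def, rule_format, where n=n and y=y and c=c] r by (simp add: less_eq_complex_def)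
  finally show "0 \<le> (\<Sum>j<n. \<Sum>l<n. of_real r * k (y j) (y l) * c j * cnj (c l))" .
qed

lemma pd_kernel_reindex:
  assumes "pd_kernel k"
  shows "pd_kernel (\<lambda>x y. k (h x) (h y))"
  unfolding pd_kernel_def
  using assms[unfolded pd_kernel_def, rule_format, where y="\<lambda>j. h (_ j)"] by blast

context compact_haar
begin

lemma pd_function_conv_star:
  assumes "cont a"
  shows "pd_function gm gi (a \<star> star a)"
  using pd_kernel_reindex[OF pd_kernel_times_conv_star[OF pd_kernel_one assms], of "\<lambda>x. (x, ())"]
    cont_continuous[OF cont_conv[OF assms cont_star[OF assms]]]
  by (simp add: pd_function_def)

lemma conv_tendsto:
  assumes a: "cont a" and q: "\<And>n. cont (q n)" and lim: "uniform_limit UNIV q p sequentially"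
    and p: "cont p"
  shows "(\<lambda>n. (q n \<star> a) x) \<longlonglongrightarrow> (p \<star> a) x"
proof (rule LIMSEQ_I)
  fix \<epsilon> :: real assume \<epsilon>: "\<epsilon> > 0"
  \<comment> \<open>The added 1 keeps \<open>C\<close> positive when \<open>a\<close> vanishes and
    yields the strict inequality at the end.\<close>
  define C where "C = sqrt (nrm2 a) + 1"
  have C: "C > 0" "sqrt (nrm2 a) < C" using nrm2_nonneg[of a] by (auto simp: C_def add_nonneg_pos)
  have "\<forall>\<^sub>F n in sequentially. \<forall>y. norm (q n y - p y) < \<epsilon> / C"
    using lim \<epsilon> C unfolding uniform_limit_iff dist_norm by simp
  then obtain N where N: "\<And>n y. n \<ge> N \<Longrightarrow> norm (q n y - p y) < \<epsilon> / C"
    unfolding eventually_sequentially by blast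
  have "norm ((q n \<star> a) x - (p \<star> a) x) < \<epsilon>" if n: "n \<ge> N" for n
  proof -
    have d: "cont (\<lambda>y. q n y - p y)" by (intro cont_intros q p)
    have "nrm2 (\<lambda>y. q n y - p y) \<le> (\<epsilon> / C)\<^sup>2"
      using N[OF n] by (intro nrm2_le_sup d) (simp add: less_imp_le)
    then have *: "sqrt (nrm2 (\<lambda>y. q n y - p y)) \<le> \<epsilon> / C"
      using \<epsilon> C by (intro real_le_lsqrt) auto
    have "norm ((q n \<star> a) x - (p \<star> a) x) \<le> sqrt (nrm2 (\<lambda>y. q n y - p y)) * sqrt (nrm2 a)"
      using conv_bound_sqrt[OF d a, of x] by (simp add: conv_diff_left q p a)
    also have "\<dots> \<le> \<epsilon> / C * sqrt (nrm2 a)"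
      by (intro mult_right_mono *) (simp add: nrm2_nonneg)
    also have "\<dots> < \<epsilon> / C * C" using \<epsilon> C by (intro mult_strict_left_mono) auto
    finally show ?thesis using C by simp
  qed
  then show "\<exists>N. \<forall>n\<ge>N. norm ((q n \<star> a) x - (p \<star> a) x) < \<epsilon>" by blast
qed

text \<open>Index \<open>n\<close> stands for the power \<open>n + 1\<close>: the algebra need not
  have a unit to serve as zeroth power. Hence the \<open>+ 1\<close> in
  \<open>pw_conv\<close>.\<close>

primrec pw :: "('g \<Rightarrow> complex) \<Rightarrow> nat \<Rightarrow> 'g \<Rightarrow> complex" where
  "pw h 0 = h"
| "pw h (Suc n) = h \<star> pw h n"

lemma cont_pw: "cont h \<Longrightarrow> cont (pw h n)"
  by (induction n) (auto intro: cont_conv)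

lemma pw_conv: "cont h \<Longrightarrow> pw h n \<star> pw h m = pw h (n + m + 1)"
  by (induction n) (simp_all add: conv_assoc cont_pw)

lemma star_pw: "cont h \<Longrightarrow> star h = h \<Longrightarrow> star (pw h n) = pw h n"
proof (induction n)
  case (Suc n)
  then show ?case using pw_conv[of h n 0] by (simp add: star_conv cont_pw)
qed simp

end

section \<open>Spectral and minimal idempotents\<close>

context gelfand
begin

lemma alg_pw: "alg h \<Longrightarrow> alg (pw h n)"
  by (induction n) (auto intro: alg_conv)

lemma alg_uniform_limit:
  assumes "\<And>n. alg (q n)" "uniform_limit UNIV q p sequentially"
  shows "alg p"
proof (rule algI)
  show "cont p" unfolding cont_def
    by (rule uniform_limit_theorem[OF _ assms(2)])
      (use assms(1) in \<open>auto simp: alg_def cont_def\<close>)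
  have lim: "(\<lambda>n. q n x) \<longlonglongrightarrow> p x" for x
    using tendsto_uniform_limitI[OF assms(2)] by simp
  show "p (k \<cdot> x) = p x" "p (x \<cdot> k) = p x" if "k \<in> K" for k x
    using LIMSEQ_unique[OF lim[of x] lim[of "k \<cdot> x", unfolded alg_left[OF assms(1) that]]]
      LIMSEQ_unique[OF lim[of x] lim[of "x \<cdot> k", unfolded alg_right[OF assms(1) that]]]
    by simp_all
qed

definition idem :: "('g \<Rightarrow> complex) \<Rightarrow> bool" where
  "idem p \<longleftrightarrow> alg p \<and> star p = p \<and> p \<star> p = p \<and> p \<noteq> (\<lambda>x. 0)"

lemma idem_unit: "idem p \<Longrightarrow> p e = of_real (nrm2 p)"
  using conv_star_unit[of p p] by (simp add: idem_def inner_self)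

lemma nrm2_pos: "cont a \<Longrightarrow> a \<noteq> (\<lambda>x. 0) \<Longrightarrow> nrm2 a > 0"
  using nrm2_eq_0[of a] nrm2_nonneg[of a] by fastforce

lemma idem_nrm2_ge_1:
  assumes "idem p"
  shows "nrm2 p \<ge> 1"
proof -
  have p: "cont p" "p \<star> p = p" "p \<noteq> (\<lambda>x. 0)" using assms by (auto simp: idem_def alg_cont)
  have "nrm2 p \<le> nrm2 p * nrm2 p" using nrm2_conv_le[OF p(1) p(1)] p(2) by simp
  then show ?thesis using nrm2_pos[OF p(1,3)] by simp
qed

text \<open>Power iteration: the even powers of \<open>h\<close>, normalised by the growth rate \<open>L\<close> of
  \<open>\<parallel>h\<^sup>n\<parallel>\<^sup>2\<close>, converge uniformly to the spectral projection for the largest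
  eigenvalue \<open>L\<close> of \<open>h \<star> h\<close>. Submultiplicativity of the norm keeps the limit away from
  \<open>0\<close>, so no compactness of the convolution operator is needed.\<close>

lemma spectral_idempotent:
  assumes h: "alg h" "star h = h" "h \<noteq> (\<lambda>x. 0)"
  obtains p L where "L > 0" "idem p" "(h \<star> h) \<star> p = (\<lambda>x. of_real L * p x)"
    "\<And>a. alg a \<Longrightarrow> a \<star> h = h \<Longrightarrow> a \<star> p = p"
proof -
  have ch: "cont h" by (rule alg_cont[OF h(1)])
  note cpw = cont_pw[OF ch] and pwc = pw_conv[OF ch] and spw = star_pw[OF ch h(2)]
  define s where "s n = nrm2 (pw h n)" for n
  have inner_pw: "inner (pw h n) (pw h m) = pw h (n + m + 1) e" for n m
    using conv_star_unit[of "pw h n" "pw h m"] by (simp add: spw pwc)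
  have s_eq: "of_real (s n) = pw h (2 * n + 1) e" for n
    using inner_self[of "pw h n"] inner_pw[of n n] by (simp add: s_def mult_2)
  \<comment> \<open>Inner products of powers depend only on the sum of the indices, so
    \<open>s (Suc n)\<close> is also the inner product of the powers with indices \<open>n\<close>
    and \<open>n + 2\<close>.\<close>
  have lc: "(s (Suc n))\<^sup>2 \<le> s n * s (Suc (Suc n))" for n
  proof -
    have "inner (pw h n) (pw h (Suc (Suc n))) = of_real (s (Suc n))"
      unfolding inner_pw s_eq by (simp add: mult_2 del: pw.simps)
    then show ?thesis
      using cauchy_schwarz[OF cpw cpw, of n "Suc (Suc n)"] by (simp add: s_def del: pw.simps)
  qed
  have s_nonneg: "s n \<ge> 0" for n by (simp add: s_def nrm2_nonneg)
  \<comment> \<open>Two consecutive terms are carried because log-convexity forces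
    \<open>s (n + 2) > 0\<close> only from \<open>s (n + 1) > 0\<close> and
    \<open>s n \<ge> 0\<close>.\<close>
  have pos2: "s n > 0 \<and> s (Suc n) > 0" for n
  proof (induction n)
    case 0
    have s0: "s 0 > 0" using nrm2_pos[OF ch h(3)] by (simp add: s_def)
    then have "pw h 1 e \<noteq> 0" using s_eq[of 0] by auto
    then have "pw h 1 \<noteq> (\<lambda>x. 0)" by auto
    then show ?case using s0 nrm2_pos[OF cpw, of 1] by (simp add: s_def)
  next
    case (Suc n)
    then have "0 < s n * s (Suc (Suc n))"
      using lc[of n] by (intro less_le_trans[OF _ lc]) simp
    then show ?case using Suc by (simp add: zero_less_mult_iff)
  qed
  then have pos: "s n > 0" for n by blast
  have sub: "s (n + k + 1) \<le> s n * s k" for n k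
    using nrm2_conv_le[OF cpw[of n] cpw[of k]] by (simp add: pwc s_def)
  obtain L where L: "L > 0" "\<And>k. L ^ Suc k \<le> s k" "convergent (\<lambda>n. s n / L ^ Suc n)"
    by (rule logconvex_submultiplicative_growth[of s, OF pos lc sub]) (rule that)
  define \<sigma> where "\<sigma> n = s n / L ^ Suc n" for n
  define \<rho> where "\<rho> n = complex_of_real (1 / L ^ Suc n)" for n
  have \<rho>_mult: "\<rho> n * (\<rho> k * z) = \<rho> (n + k + 1) * z" and \<rho>_Suc: "of_real L * (\<rho> (Suc n) * z) = \<rho> n * z"
    and \<rho>_cnj: "cnj (\<rho> n) = \<rho> n" for n k z
    using L(1) by (simp_all add: \<rho>_def power_add field_simps)
  \<comment> \<open>This is the power \<open>n + 1\<close> of \<open>h \<star> h\<close> divided by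
    \<open>L ^ (n + 1)\<close>.\<close>
  define q where "q n = (\<lambda>x. \<rho> n * pw h (2 * n + 1) x)" for n
  have aq: "alg (q n)" for n unfolding q_def by (intro alg_scale alg_pw h)
  note cq = alg_cont[OF aq]
  have sq: "star (q n) = q n" for n
    using spw[of "2 * n + 1"] by (simp add: q_def star_def fun_eq_iff \<rho>_cnj del: pw.simps)
  have q_conv: "q n \<star> q k = q (n + k + 1)" for n k
    by (simp add: q_def conv_scale_left conv_scale_right pwc \<rho>_mult mult_2 add_ac del: pw.simps)
  have inner_q: "inner (q n) (q k) = of_real (\<sigma> (n + k + 1))" for n k
  proof -
    have "inner (q n) (q k) = q (n + k + 1) e"
      using conv_star_unit[of "q n" "q k"] by (simp only: sq q_conv)
    also have "\<dots> = of_real (\<sigma> (n + k + 1))"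
      unfolding q_def s_eq[symmetric] by (simp add: \<rho>_def \<sigma>_def)
    finally show ?thesis .
  qed
  have nrm2_q: "nrm2 (q n) = \<sigma> (2 * n + 1)" for n
    using inner_q[of n n] unfolding inner_self of_real_eq_iff by (simp add: mult_2)
  have hq: "pw h 1 \<star> q n = (\<lambda>x. of_real L * q (Suc n) x)" for n
    by (simp add: q_def conv_scale_right pwc \<rho>_Suc del: pw.simps)
  obtain m where m: "\<sigma> \<longlonglongrightarrow> m" using L(3) by (auto simp: convergent_def \<sigma>_def[abs_def])
  \<comment> \<open>The squared norm of \<open>q m - q n\<close> is a combination of values of the
    convergent \<open>\<sigma>\<close>, so the sequence is Cauchy in L2. Convolution with
    \<open>pw h 1\<close> shifts the index and multiplies by \<open>L\<close>, which is why the
    uniform estimate comes out for \<open>q (Suc n)\<close>.\<close>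
  have "uniformly_Cauchy_on UNIV (\<lambda>n. q (Suc n))"
  proof (rule uniformly_Cauchy_onI)
    fix \<epsilon> :: real assume \<epsilon>: "\<epsilon> > 0"
    \<comment> \<open>Chosen so that \<open>s 1 * (4 * \<delta>) = (L * \<epsilon>)\<^sup>2\<close>:
      the norm identity uses \<open>\<sigma>\<close> with total weight 4, and
      \<open>conv_bound\<close> contributes \<open>s 1\<close>.\<close>
    define \<delta> where "\<delta> = \<epsilon>\<^sup>2 * L\<^sup>2 / (4 * s 1)"
    have "\<delta> > 0" using \<epsilon> L pos by (simp add: \<delta>_def)
    then obtain N where N: "\<And>n. n \<ge> N \<Longrightarrow> \<bar>\<sigma> n - m\<bar> < \<delta>"
      using LIMSEQ_D[OF m, of \<delta>] by auto
    have "dist (q (Suc m) x) (q (Suc n) x) < \<epsilon>" if mn: "m \<ge> N" "n \<ge> N" for m n x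
    proof -
      let ?d = "\<lambda>x. q m x - q n x"
      have d: "cont ?d" by (intro cont_intros cq)
      have "nrm2 ?d = \<sigma> (2 * m + 1) - 2 * \<sigma> (m + n + 1) + \<sigma> (2 * n + 1)"
        by (simp add: nrm2_diff[OF cq cq] nrm2_q inner_q)
      also have "\<dots> < 4 * \<delta>"
        using N[of "2 * m + 1"] N[of "m + n + 1"] N[of "2 * n + 1"] mn by linarith
      finally have nd: "nrm2 ?d < 4 * \<delta>" .
      have "pw h 1 \<star> ?d = ?d \<star> pw h 1" by (intro alg_comm alg_diff aq alg_pw h)
      also have "\<dots> = (\<lambda>x. (q m \<star> pw h 1) x - (q n \<star> pw h 1) x)"
        by (intro conv_diff_left cq cpw)
      also have "q m \<star> pw h 1 = pw h 1 \<star> q m" by (intro alg_comm aq alg_pw h)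
      also have "q n \<star> pw h 1 = pw h 1 \<star> q n" by (intro alg_comm aq alg_pw h)
      finally have "(pw h 1 \<star> ?d) x = of_real L * (q (Suc m) x - q (Suc n) x)"
        unfolding hq by (simp add: right_diff_distrib)
      then have "(L * norm (q (Suc m) x - q (Suc n) x))\<^sup>2 = (norm ((pw h 1 \<star> ?d) x))\<^sup>2"
        using L by (simp add: norm_mult)
      also have "\<dots> \<le> s 1 * nrm2 ?d" unfolding s_def by (rule conv_bound[OF cpw d])
      also have "\<dots> < s 1 * (4 * \<delta>)" using nd pos by simp
      also have "\<dots> = (L * \<epsilon>)\<^sup>2" using pos[of 1] by (simp add: \<delta>_def power_mult_distrib)
      finally have "L * norm (q (Suc m) x - q (Suc n) x) < L * \<epsilon>"
        by (rule power2_less_imp_less) (use L \<epsilon> in simp)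
      then show ?thesis using L by (simp add: dist_norm)
    qed
    then show "\<exists>M. \<forall>x\<in>UNIV. \<forall>m\<ge>M. \<forall>n\<ge>M. dist (q (Suc m) x) (q (Suc n) x) < \<epsilon>" by blast
  qed
  then obtain p where p: "uniform_limit UNIV (\<lambda>n. q (Suc n)) p sequentially"
    using Cauchy_uniformly_convergent uniformly_convergent_on_def by blast
  have ap: "alg p" by (rule alg_uniform_limit[OF aq p])
  note cp = alg_cont[OF ap]
  have lim: "(\<lambda>n. q (Suc n) x) \<longlonglongrightarrow> p x" for x
    using tendsto_uniform_limitI[OF p] by simp
  have lim_shift: "(\<lambda>n. q (Suc n + k) x) \<longlonglongrightarrow> p x" for k x
    using LIMSEQ_ignore_initial_segment[OF lim, of k x] by simp
  have conv_lim: "(\<lambda>n. (q (Suc n) \<star> a) x) \<longlonglongrightarrow> (p \<star> a) x" if "cont a" for a x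
    by (rule conv_tendsto[OF that cq p cp])
  have star_p: "star p = p"
  proof
    fix x
    have "(\<lambda>n. star (q (Suc n)) x) \<longlonglongrightarrow> star p x"
      unfolding star_def by (intro tendsto_cnj lim)
    then show "star p x = p x" unfolding sq using lim[of x] by (rule LIMSEQ_unique)
  qed
  have "p \<star> q k = p" for k
  proof
    fix x
    have "(\<lambda>n. (q (Suc n) \<star> q k) x) \<longlonglongrightarrow> p x"
      unfolding q_conv using lim_shift[of "k + 1" x] by simp
    then show "(p \<star> q k) x = p x" by (rule LIMSEQ_unique[OF conv_lim[OF cq]])
  qed
  then have qp: "q k \<star> p = p" for k using alg_comm[OF aq ap] by simp
  have pp: "p \<star> p = p"
  proof
    fix x show "(p \<star> p) x = p x"
      using LIMSEQ_unique[OF conv_lim[OF cp, unfolded qp] tendsto_const, of x] by simp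
  qed
  have "p \<noteq> (\<lambda>x. 0)"
  proof
    assume "p = (\<lambda>x. 0)"
    then have "\<forall>\<^sub>F n in sequentially. \<forall>x. norm (q (Suc n) x) < 1 / 2"
      using p unfolding uniform_limit_iff dist_norm by (auto dest: spec[of _ "1 / 2"])
    then obtain n where n: "\<And>x. norm (q (Suc n) x) < 1 / 2"
      unfolding eventually_sequentially by blast
    have "nrm2 (q (Suc n)) \<le> (1 / 2)\<^sup>2"
      by (intro nrm2_le_sup cq less_imp_le n)
    moreover have "nrm2 (q (Suc n)) \<ge> 1"
      unfolding nrm2_q \<sigma>_def using L(1,2) by (simp del: power_Suc)
    ultimately show False by (simp add: power2_eq_square)
  qed
  then have idem: "idem p" by (simp add: idem_def ap star_p pp)
  have "(h \<star> h) \<star> p = p \<star> (h \<star> h)" by (intro alg_comm alg_conv h ap)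
  also have "\<dots> = (\<lambda>x. of_real L * p x)"
  proof
    fix x
    have "(\<lambda>n. (q (Suc n) \<star> pw h 1) x) \<longlonglongrightarrow> of_real L * p x"
      unfolding alg_comm[OF aq alg_pw[OF h(1)]] hq
      using tendsto_mult_left[OF lim_shift[of 1]] by simp
    then show "(p \<star> (h \<star> h)) x = of_real L * p x"
      using LIMSEQ_unique[OF conv_lim[OF cpw[of 1]]] by simp
  qed
  finally have hp: "(h \<star> h) \<star> p = (\<lambda>x. of_real L * p x)" .
  \<comment> \<open>\<open>p\<close> is a limit of scaled powers of \<open>h\<close>, so whatever
    acts as a unit on \<open>h\<close> acts as a unit on \<open>p\<close>. This is how
    \<open>p\<close> is later placed below a given idempotent.\<close>
  have "a \<star> p = p" if a: "alg a" "a \<star> h = h" for a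
  proof -
    have "a \<star> pw h n = pw h n" for n
      using a ch cpw by (cases n) (simp_all add: alg_cont flip: conv_assoc)
    then have "a \<star> q n = q n" for n by (simp add: q_def conv_scale_right del: pw.simps)
    then have qa: "q n \<star> a = q n" for n using alg_comm[OF a(1) aq] by simp
    have "(p \<star> a) x = p x" for x
      using LIMSEQ_unique[OF conv_lim[OF alg_cont[OF a(1)], unfolded qa] lim] .
    then show ?thesis using alg_comm[OF a(1) ap] by auto
  qed
  then show thesis by (rule that[OF L(1) idem hp])
qed

text \<open>The difference is again an idempotent of the algebra. Squared norms of idempotents are
  their values at \<open>e\<close>, so they subtract, and the difference has squared norm at least
  1.\<close>

lemma idem_diff:
  assumes p: "idem p" and q: "idem q" and pq: "p \<star> q = q" and ne: "q \<noteq> p"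
  shows "nrm2 p \<ge> nrm2 q + 1"
proof -
  let ?d = "\<lambda>x. p x - q x"
  have a: "alg p" "alg q" and c: "cont p" "cont q" and s: "star p = p" "star q = q"
    and i: "p \<star> p = p" "q \<star> q = q"
    using p q by (auto simp: idem_def alg_cont)
  have qp: "q \<star> p = q" using alg_comm[OF a] pq by simp
  have ad: "alg ?d" by (intro alg_intros a)
  have sd: "star ?d = ?d"
    using fun_cong[OF s(1)] fun_cong[OF s(2)] by (simp add: star_def fun_eq_iff)
  have "p \<star> ?d = ?d \<star> p" by (rule alg_comm[OF a(1) ad])
  then have pd: "p \<star> ?d = ?d" using conv_diff_left[OF c c(1)] by (simp add: i qp)
  have "q \<star> ?d = ?d \<star> q" by (rule alg_comm[OF a(2) ad])
  then have qd: "q \<star> ?d = (\<lambda>x. 0)" using conv_diff_left[OF c c(2)] by (simp add: i pq)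
  have dd: "?d \<star> ?d = ?d"
    using conv_diff_left[OF c alg_cont[OF ad]] by (simp add: pd qd)
  have "?d \<noteq> (\<lambda>x. 0)"
  proof
    assume "?d = (\<lambda>x. 0)"
    then have "p x - q x = 0" for x by (rule fun_cong)
    then have "q = p" by (intro ext) simp
    with ne show False by contradiction
  qed
  then have d: "idem ?d" using ad sd dd by (simp add: idem_def)
  have "complex_of_real (nrm2 ?d) = of_real (nrm2 p - nrm2 q)"
    using idem_unit[OF d] idem_unit[OF p] idem_unit[OF q] by simp
  then have "nrm2 ?d = nrm2 p - nrm2 q" by (simp only: of_real_eq_iff)
  then show ?thesis using idem_nrm2_ge_1[OF d] by linarith
qed

text \<open>Each strict descent lowers \<open>nrm2\<close> by at least 1, so its integer part still
  drops and a least value exists among the natural numbers.\<close>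

lemma minimal_idempotent:
  assumes "idem p0"
  obtains p where "idem p" "p0 \<star> p = p" "\<And>q. idem q \<Longrightarrow> p \<star> q = q \<Longrightarrow> q = p"
proof -
  have "idem p0 \<and> p0 \<star> p0 = p0" using assms by (simp add: idem_def)
  from ex_has_least_nat[of "\<lambda>p. idem p \<and> p0 \<star> p = p", OF this, of "\<lambda>p. nat \<lfloor>nrm2 p\<rfloor>"]
  obtain p where p: "idem p" "p0 \<star> p = p"
    and least: "\<forall>q. idem q \<and> p0 \<star> q = q \<longrightarrow> nat \<lfloor>nrm2 p\<rfloor> \<le> nat \<lfloor>nrm2 q\<rfloor>"
    by (elim exE conjE)
  have "q = p" if q: "idem q" "p \<star> q = q" for q
  proof (rule ccontr)
    assume "q \<noteq> p"
    then have 1: "nrm2 q + 1 \<le> nrm2 p" by (rule idem_diff[OF p(1) q])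
    have "p0 \<star> q = p0 \<star> p \<star> q"
      using conv_assoc[of p0 p q] assms p q by (simp add: idem_def alg_cont)
    then have "nat \<lfloor>nrm2 p\<rfloor> \<le> nat \<lfloor>nrm2 q\<rfloor>" using least p q by simp
    then show False using 1 nrm2_nonneg[of q] by linarith
  qed
  then show thesis by (rule that[OF p])
qed

end

section \<open>Scalar action on a minimal idempotent and the functional equation\<close>

context gelfand
begin

text \<open>For nonzero \<open>b\<close> of this kind the spectral idempotent lies below
  \<open>p\<close>, so it is \<open>p\<close>, and \<open>b \<star> b\<close> is a positive multiple
  of \<open>p\<close>. With \<open>a \<star> a = L p\<close> and \<open>t = sqrt L\<close>, the
  factors \<open>a - t p\<close> and \<open>a + t p\<close> have product 0.\<close>

lemma minimal_selfadjoint_scalar: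
  assumes p: "idem p" and min: "\<And>q. idem q \<Longrightarrow> p \<star> q = q \<Longrightarrow> q = p"
    and a: "alg a" "star a = a" "p \<star> a = a"
  shows "\<exists>t::real. a = (\<lambda>x. of_real t * p x)"
proof -
  have ap: "alg p" and cp: "cont p" and sp: "star p = p" and pp: "p \<star> p = p"
    using p by (auto simp: idem_def alg_cont)
  have square: "\<exists>L>0. b \<star> b = (\<lambda>x. of_real L * p x)"
    if b: "alg b" "star b = b" "p \<star> b = b" "b \<noteq> (\<lambda>x. 0)" for b
  proof -
    obtain q L where q: "L > 0" "idem q" "(b \<star> b) \<star> q = (\<lambda>x. of_real L * q x)"
        "\<And>a. alg a \<Longrightarrow> a \<star> b = b \<Longrightarrow> a \<star> q = q"
      using spectral_idempotent[OF b(1,2,4)] by blast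
    have "q = p" using min q(2) q(4)[OF ap b(3)] by blast
    moreover have "(b \<star> b) \<star> p = b \<star> b"
      using alg_comm[OF ap b(1)] b by (simp add: conv_assoc alg_cont cp)
    ultimately show ?thesis using q(1,3) by auto
  qed
  show ?thesis
  proof (cases "a = (\<lambda>x. 0)")
    case True
    then show ?thesis by (intro exI[of _ 0]) simp
  next
    case False
    obtain L where L: "L > 0" "a \<star> a = (\<lambda>x. of_real L * p x)" using square[OF a False] by blast
    define t where "t = sqrt L"
    have tt: "complex_of_real t * of_real t = of_real L"
      using L(1) by (simp add: t_def flip: of_real_mult)
    let ?b = "\<lambda>x. a x - of_real t * p x" and ?c = "\<lambda>x. a x + of_real t * p x"
    have ca: "cont a" using a alg_cont by blast
    have ctp: "cont (\<lambda>x. of_real t * p x)" by (intro cont_intros cp)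
    have ab: "alg ?b" and ac: "alg ?c" by (intro alg_intros a ap)+
    have sb: "star ?b = ?b"
      using fun_cong[OF a(2)] fun_cong[OF sp] by (simp add: star_def fun_eq_iff)
    have "p \<star> ?b = ?b \<star> p" by (rule alg_comm[OF ap ab])
    also have "\<dots> = ?b"
      using conv_diff_left[OF ca ctp cp] alg_comm[OF a(1) ap] by (simp add: a pp conv_scale_left)
    finally have pb: "p \<star> ?b = ?b" .
    have "p \<star> ?c = ?c \<star> p" by (rule alg_comm[OF ap ac])
    also have "\<dots> = ?c"
      using conv_add_left[OF ca ctp cp] alg_comm[OF a(1) ap] by (simp add: a pp conv_scale_left)
    finally have pc: "p \<star> ?c = ?c" .
    have "?b \<star> ?c = (\<lambda>x. (a \<star> ?c) x - of_real t * ?c x)"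
      using conv_diff_left[OF ca ctp alg_cont[OF ac]] by (simp only: conv_scale_left pc)
    also have "a \<star> ?c = ?c \<star> a" by (rule alg_comm[OF a(1) ac])
    also have "\<dots> = (\<lambda>x. of_real L * p x + of_real t * a x)"
      using conv_add_left[OF ca ctp ca] by (simp only: conv_scale_left a L)
    finally have bc: "?b \<star> ?c = (\<lambda>x. 0)" by (simp add: distrib_left tt flip: mult.assoc)
    show ?thesis
    proof (cases "?b = (\<lambda>x. 0)")
      case True
      then show ?thesis by (intro exI[of _ t]) (simp add: fun_eq_iff)
    next
      case False
      obtain M where M: "M > 0" "?b \<star> ?b = (\<lambda>x. of_real M * p x)"
        using square[OF ab sb pb False] by blast
      \<comment> \<open>As \<open>?b \<star> ?b\<close> is a positive multiple of \<open>p\<close>,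
        the element \<open>?b\<close> is invertible relative to \<open>p\<close> and can be
        cancelled from \<open>?b \<star> ?c = 0\<close>.\<close>
      have "?b \<star> (?b \<star> ?c) = (?b \<star> ?b) \<star> ?c"
        by (intro conv_assoc[symmetric] alg_cont ab ac)
      also have "\<dots> = (\<lambda>x. of_real M * ?c x)" unfolding M conv_scale_left pc ..
      finally have "(\<lambda>x. of_real M * ?c x) = (\<lambda>x. 0)"
        unfolding bc by (simp add: convolution_def fun_eq_iff)
      then have "of_real M * ?c x = 0" for x by (rule fun_cong)
      then have "a x = of_real (- t) * p x" for x
        using M(1) by (simp add: eq_neg_iff_add_eq_0)
      then show ?thesis by (intro exI[of _ "- t"] ext)
    qed
  qed
qed

text \<open>\<open>p \<star> a\<close> splits into the self-adjoint parts \<open>u + star u\<close>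
  and \<open>\<i> * (u - star u)\<close>; by commutativity \<open>p\<close> fixes
  \<open>star u\<close> as well, so both parts are real multiples of \<open>p\<close>.\<close>

lemma minimal_scalar:
  assumes p: "idem p" and min: "\<And>q. idem q \<Longrightarrow> p \<star> q = q \<Longrightarrow> q = p" and a: "alg a"
  shows "\<exists>t. p \<star> a = (\<lambda>x. t * p x)"
proof -
  have ap: "alg p" and cp: "cont p" and sp: "star p = p" and pp: "p \<star> p = p"
    using p by (auto simp: idem_def alg_cont)
  define u where "u = p \<star> a"
  have au: "alg u" unfolding u_def by (intro alg_conv ap a)
  have pu: "p \<star> u = u" unfolding u_def using conv_assoc[OF cp cp alg_cont[OF a]] by (simp add: pp)
  have "star u = star a \<star> p" unfolding u_def using star_conv[OF cp alg_cont[OF a]] by (simp add: sp)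
  also have "\<dots> = p \<star> star a" by (intro alg_comm alg_star a ap)
  finally have psu: "p \<star> star u = star u"
    using conv_assoc[OF cp cp cont_star[OF alg_cont[OF a]]] by (simp add: pp)
  note asu = alg_star[OF au]
  have up: "u \<star> p = u" "star u \<star> p = star u"
    using alg_comm[OF ap au] alg_comm[OF ap asu] pu psu by simp_all
  let ?r = "\<lambda>x. u x + star u x" and ?i = "\<lambda>x. \<i> * (u x - star u x)"
  have r: "alg ?r" "star ?r = ?r" and i: "alg ?i" "star ?i = ?i"
    by (intro alg_intros au asu, simp add: star_def fun_eq_iff add.commute,
        intro alg_intros au asu, simp add: star_def fun_eq_iff algebra_simps)
  have "p \<star> ?r = ?r \<star> p" by (rule alg_comm[OF ap r(1)])
  also have "\<dots> = ?r" using conv_add_left[OF alg_cont[OF au] alg_cont[OF asu] cp] by (simp add: up)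
  finally obtain s :: real where s: "?r = (\<lambda>x. of_real s * p x)"
    using minimal_selfadjoint_scalar[OF p min r] by blast
  have "p \<star> ?i = ?i \<star> p" by (rule alg_comm[OF ap i(1)])
  also have "\<dots> = ?i"
    using conv_diff_left[OF alg_cont[OF au] alg_cont[OF asu] cp] by (simp add: up conv_scale_left)
  finally obtain t :: real where t: "?i = (\<lambda>x. of_real t * p x)"
    using minimal_selfadjoint_scalar[OF p min i] by blast
  have "u x = (of_real s - \<i> * of_real t) / 2 * p x" for x
  proof -
    have "u x = (?r x - \<i> * ?i x) / 2" by (simp add: algebra_simps)
    also have "\<dots> = (of_real s - \<i> * of_real t) / 2 * p x"
      unfolding fun_cong[OF s, of x] fun_cong[OF t, of x] by (simp add: algebra_simps)
    finally show ?thesis .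
  qed
  then show ?thesis unfolding u_def by (intro exI ext)
qed

text \<open>Let \<open>F\<close> be the left-hand integral as a function of \<open>y\<close>. For
  \<open>a\<close> in the algebra, \<open>(F \<star> a) e = (p \<star> a) x\<close>, and if
  \<open>p \<star> a = t p\<close> this is \<open>t * p x\<close>, while
  \<open>(p \<star> a) e = t * p e\<close>. With \<open>a = star G\<close> for
  \<open>G = p e F - p x p\<close> the two contributions to \<open>inner G G\<close> cancel.\<close>

lemma minimal_functional_equation:
  assumes p: "idem p" and min: "\<And>q. idem q \<Longrightarrow> p \<star> q = q \<Longrightarrow> q = p"
  shows "(LINT k|\<omega>K. p (x \<cdot> k \<cdot> y)) * p e = p x * p y"
proof -
  have ap: "alg p" and cp: "cont p" using p by (auto simp: idem_def alg_cont)
  define F where "F y = (LINT k|\<omega>K. p (x \<cdot> k \<cdot> y))" for y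
  have aF: "alg F"
  proof (rule algI)
    show "cont F" unfolding F_def[abs_def] cont_def
      by (intro continuous_integral[OF borel_prob_K] cont_compose[OF cp] continuous_intros)
    show "F (y \<cdot> k) = F y" if "k \<in> K" for k y
      using alg_right[OF ap that] by (simp add: F_def flip: assoc)
    show "F (l \<cdot> y) = F y" if "l \<in> K" for l y
      using haar_K_right[OF that, of "\<lambda>k. p (x \<cdot> k \<cdot> y)"]
      by (simp add: F_def assoc cont_compose[OF cp] continuous_intros)
  qed
  have F_conv: "(F \<star> a) e = (p \<star> a) x" if a: "alg a" for a
  proof -
    note ca = alg_cont[OF a]
    have "(F \<star> a) e = (LINT y|\<omega>. LINT k|\<omega>K. p (x \<cdot> k \<cdot> y) * a (gi y))"
      by (simp add: convolution_def F_def)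
    also have "\<dots> = (LINT k|\<omega>K. LINT y|\<omega>. p (x \<cdot> k \<cdot> y) * a (gi y))"
      by (intro fubini[OF borel_prob borel_prob_K] continuous_intros cont_compose[OF cp] cont_compose[OF ca])
    also have "\<dots> = (LINT k|\<omega>K. (p \<star> a) (x \<cdot> k))"
    proof (rule Bochner_Integration.integral_cong[OF refl])
      fix k
      have "(LINT y|\<omega>. p (x \<cdot> k \<cdot> y) * a (gi (x \<cdot> k \<cdot> y) \<cdot> (x \<cdot> k)))
          = (LINT y|\<omega>. p y * a (gi y \<cdot> (x \<cdot> k)))"
        by (rule haar_left) (intro continuous_intros cont_compose[OF cp] cont_compose[OF ca])
      then show "(LINT y|\<omega>. p (x \<cdot> k \<cdot> y) * a (gi y)) = (p \<star> a) (x \<cdot> k)"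
        by (simp add: convolution_def assoc)
    qed
    also have "\<dots> = (LINT k|\<omega>K. (p \<star> a) x)"
      using alg_right[OF alg_conv[OF ap a]]
      by (intro haar_K_cong cont_compose[OF cont_conv[OF cp ca]] continuous_intros)
    finally show ?thesis by (simp only: integral_K_const)
  qed
  define G where "G = (\<lambda>y. p e * F y - p x * p y)"
  have aG: "alg G" unfolding G_def by (intro alg_intros aF ap)
  obtain t where t: "p \<star> star G = (\<lambda>x. t * p x)" using minimal_scalar[OF p min alg_star[OF aG]] by blast
  have "inner F G = t * p x" "inner p G = t * p e"
    using F_conv[OF alg_star[OF aG]] conv_star_unit[of F G] conv_star_unit[of p G] t by simp_all
  moreover have "inner G G = inner (\<lambda>y. p e * F y - p x * p y) G"
    by (simp add: G_def)
  then have "inner G G = p e * inner F G - p x * inner p G"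
    using inner_diff_left[of "\<lambda>y. p e * F y" "\<lambda>y. p x * p y" G]
    by (simp add: inner_scale_left alg_cont alg_scale aF ap aG)
  ultimately have "inner G G = 0" by simp
  then have "nrm2 G = 0" by (simp add: inner_self)
  then have "G y = 0" using nrm2_eq_0[OF alg_cont[OF aG]] by blast
  then show ?thesis by (simp add: G_def F_def mult.commute)
qed

definition Z :: "('g \<Rightarrow> complex) set" where
  "Z = pd_spherical gm gi e \<omega>K"

lemma minimal_spherical:
  assumes p: "idem p" and min: "\<And>q. idem q \<Longrightarrow> p \<star> q = q \<Longrightarrow> q = p"
  shows "(\<lambda>x. p x / p e) \<in> Z"
proof -
  have cp: "cont p" and pp: "p \<star> star p = p" using p by (auto simp: idem_def alg_cont)
  have pos: "nrm2 p > 0" using idem_nrm2_ge_1[OF p] by simp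
  note pe = idem_unit[OF p]
  have pe0: "p e \<noteq> 0" using pos pe by simp
  have cont: "continuous_on UNIV (\<lambda>x. p x / p e)"
    using pe0 by (intro continuous_intros cont_continuous cp) auto
  have "pd_kernel (\<lambda>x y. p (gi x \<cdot> y))"
    using pd_function_conv_star[OF cp] by (simp add: pd_function_def pp)
  then have "pd_kernel (\<lambda>x y. p (gi x \<cdot> y) / p e)"
    using pd_kernel_scale[of _ "1 / nrm2 p"] pos by (simp add: pe)
  moreover have "(LINT k|\<omega>K. p (x \<cdot> k \<cdot> y) / p e) = p x / p e * (p y / p e)" for x y
  proof -
    have "(LINT k|\<omega>K. p (x \<cdot> k \<cdot> y) / p e) = (LINT k|\<omega>K. p (x \<cdot> k \<cdot> y)) / p e"
      by simp
    also have "\<dots> = p x / p e * (p y / p e)"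
      using minimal_functional_equation[OF p min, of x y] pe0 by (simp add: field_simps)
    finally show ?thesis .
  qed
  ultimately show ?thesis
    using cont pe0 by (simp add: Z_def pd_spherical_def spherical_def pd_function_def)
qed

end

section \<open>Orthogonality and completeness of the spherical functions\<close>

lemma pd_kernel_two:
  assumes "pd_kernel k"
  shows "k x x * a * cnj a + k x y * a * cnj b + (k y x * b * cnj a + k y y * b * cnj b) \<ge> 0"
  using assms[unfolded pd_kernel_def, rule_format, where n=2 and y="\<lambda>j. if j = 0 then x else y"
      and c="\<lambda>j. if j = 0 then a else b"]
  by (simp add: numeral_2_eq_2)

lemma pd_kernel_diag: "pd_kernel k \<Longrightarrow> k x x \<ge> 0"
  using pd_kernel_two[of k x 1 x 0] by simp

lemma pd_kernel_hermitian:
  assumes "pd_kernel k"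
  shows "k y x = cnj (k x y)"
proof (rule complex_eqI)
  have "Im (k x x) = 0" "Im (k y y) = 0"
    using pd_kernel_diag[OF assms, of x] pd_kernel_diag[OF assms, of y] by (simp_all add: less_eq_complex_def)
  then show "Re (k y x) = Re (cnj (k x y))" "Im (k y x) = Im (cnj (k x y))"
    using pd_kernel_two[OF assms, of x 1 y 1] pd_kernel_two[OF assms, of x 1 y \<i>]
    by (simp_all add: less_eq_complex_def)
qed

text \<open>The arithmetic mean, rather than the geometric one, makes the majorant of an
  off-diagonal series a sum of two summable diagonals.\<close>

lemma pd_kernel_norm_le:
  assumes k: "pd_kernel k"
  shows "norm (k x y) \<le> (Re (k x x) + Re (k y y)) / 2"
proof (cases "k x y = 0")
  case True
  then show ?thesis
    using pd_kernel_diag[OF k, of x] pd_kernel_diag[OF k, of y] by (simp add: less_eq_complex_def)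
next
  case False
  \<comment> \<open>\<open>b\<close> is minus the phase of \<open>z\<close>, so both cross terms
    become \<open>- norm z\<close>.\<close>
  define z b where "z = k x y" and "b = - z / of_real (norm z)"
  have nz: "norm z \<noteq> 0" using False by (simp add: z_def)
  have zz: "z * cnj z = of_real (norm z) * of_real (norm z)"
    using complex_norm_square[of z] by (simp add: power2_eq_square)
  have "z * cnj b = - of_real (norm z)" "cnj z * b = - of_real (norm z)" "b * cnj b = 1"
    using nz zz by (simp_all add: b_def mult.commute[of "cnj z" z])
  then have "k x x - of_real (norm z) + (- of_real (norm z) + k y y) \<ge> 0"
    using pd_kernel_two[OF k, of x 1 y b]
    by (simp add: z_def pd_kernel_hermitian[OF k, of y x] mult.assoc)
  then show ?thesis by (simp add: less_eq_complex_def z_def)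
qed

context gelfand
begin

context
  fixes \<phi> assumes \<phi>: "\<phi> \<in> Z"
begin

lemma Z_cont: "cont \<phi>"
  using \<phi> by (simp add: Z_def pd_spherical_def spherical_def cont_def)

lemma Z_unit: "\<phi> e = 1"
  using \<phi> by (simp add: Z_def pd_spherical_def spherical_def)

lemma Z_product: "(LINT k|\<omega>K. \<phi> (x \<cdot> k \<cdot> y)) = \<phi> x * \<phi> y"
  using \<phi> by (simp add: Z_def pd_spherical_def spherical_def)

lemma Z_pd: "pd_kernel (\<lambda>x y. \<phi> (gi x \<cdot> y))"
  using \<phi> by (simp add: Z_def pd_spherical_def pd_function_def)

lemma Z_star: "star \<phi> = \<phi>"
proof
  show "star \<phi> x = \<phi> x" for x
    using pd_kernel_hermitian[OF Z_pd, of x e] by (simp add: star_def)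
qed

lemma Z_norm_le: "norm (\<phi> x) \<le> 1"
  using pd_kernel_norm_le[OF Z_pd, of e x] by (simp add: Z_unit)

text \<open>Right invariance comes from the functional equation at \<open>y = e\<close>, where a
  factor from \<open>K\<close> is absorbed by the integral; left invariance follows through
  \<open>star \<phi> = \<phi>\<close>.\<close>

lemma Z_alg: "alg \<phi>"
proof (rule algI[OF Z_cont])
  show right: "\<phi> (x \<cdot> l) = \<phi> x" if l: "l \<in> K" for l x
  proof -
    have "\<phi> (x \<cdot> l) = (LINT k|\<omega>K. \<phi> (x \<cdot> (l \<cdot> k)))"
      using Z_product[of "x \<cdot> l" e] by (simp add: Z_unit assoc)
    also have "\<dots> = (LINT k|\<omega>K. \<phi> (x \<cdot> k))"
      by (intro haar_K_left[OF l, of "\<lambda>k. \<phi> (x \<cdot> k)"] cont_compose[OF Z_cont] continuous_intros)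
    also have "\<dots> = \<phi> x" using Z_product[of x e] by (simp add: Z_unit)
    finally show ?thesis .
  qed
  show "\<phi> (l \<cdot> x) = \<phi> x" if l: "l \<in> K" for l x
    using right[OF inv_K[OF l], of "gi x"] fun_cong[OF Z_star, of x] fun_cong[OF Z_star, of "l \<cdot> x"]
    by (simp add: star_def)
qed

text \<open>Averaging the left-invariant convolution over \<open>K\<close> inserts \<open>k\<close>
  between \<open>gi y\<close> and \<open>x\<close>, where the functional equation factors the
  integrand.\<close>

lemma conv_Z:
  assumes a: "alg a"
  shows "a \<star> \<phi> = (\<lambda>x. inner a \<phi> * \<phi> x)"
proof
  fix x
  note ca = alg_cont[OF a]
  have "(a \<star> \<phi>) x = (LINT k|\<omega>K. (a \<star> \<phi>) x)" by (simp only: integral_K_const)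
  also have "\<dots> = (LINT k|\<omega>K. (a \<star> \<phi>) (k \<cdot> x))"
    using alg_left[OF alg_conv[OF a Z_alg]]
    by (intro haar_K_cong cont_compose[OF cont_conv[OF ca Z_cont]] continuous_intros) simp
  also have "\<dots> = (LINT k|\<omega>K. LINT y|\<omega>. a y * \<phi> (gi y \<cdot> k \<cdot> x))"
    by (simp add: convolution_def assoc)
  also have "\<dots> = (LINT y|\<omega>. LINT k|\<omega>K. a y * \<phi> (gi y \<cdot> k \<cdot> x))"
    by (intro fubini[OF borel_prob_K borel_prob] continuous_intros cont_compose[OF Z_cont] cont_compose[OF ca])
  also have "\<dots> = (LINT y|\<omega>. a y * cnj (\<phi> y) * \<phi> x)"
  proof (rule Bochner_Integration.integral_cong[OF refl])
    show "(LINT k|\<omega>K. a y * \<phi> (gi y \<cdot> k \<cdot> x)) = a y * cnj (\<phi> y) * \<phi> x" for y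
      using fun_cong[OF Z_star, of "gi y"] by (simp add: Z_product star_def)
  qed
  finally show "(a \<star> \<phi>) x = inner a \<phi> * \<phi> x" by (simp add: inner_def)
qed

lemma Z_nrm2_pos: "nrm2 \<phi> > 0"
proof (rule nrm2_pos[OF Z_cont])
  show "\<phi> \<noteq> (\<lambda>x. 0)" using Z_unit by auto
qed

lemma Z_conv_self: "\<phi> \<star> \<phi> = (\<lambda>x. of_real (nrm2 \<phi>) * \<phi> x)"
  using conv_Z[OF Z_alg] by (simp add: inner_self)

end

text \<open>Each function is an eigenvector of convolution by the other. Commutativity gives
  \<open>inner \<phi> \<psi> * \<psi> = inner \<psi> \<phi> * \<phi>\<close>; at \<open>e\<close>
  the scalars agree, so a nonzero scalar would force equality.\<close>

lemma Z_orthogonal: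
  assumes \<phi>: "\<phi> \<in> Z" and \<psi>: "\<psi> \<in> Z" and ne: "\<phi> \<noteq> \<psi>"
  shows "inner \<phi> \<psi> = 0"
proof -
  have "(\<lambda>x. inner \<phi> \<psi> * \<psi> x) = (\<lambda>x. inner \<psi> \<phi> * \<phi> x)"
    using conv_Z[OF \<psi> Z_alg[OF \<phi>]] conv_Z[OF \<phi> Z_alg[OF \<psi>]] alg_comm[OF Z_alg[OF \<phi>] Z_alg[OF \<psi>]]
    by simp
  then have *: "inner \<phi> \<psi> * \<psi> x = inner \<psi> \<phi> * \<phi> x" for x by (rule fun_cong)
  from *[of e] have eq: "inner \<psi> \<phi> = inner \<phi> \<psi>" by (simp add: Z_unit \<phi> \<psi>)
  obtain x where "\<phi> x \<noteq> \<psi> x" using ne by (auto simp: fun_eq_iff)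
  then show ?thesis using *[of x] by (simp add: eq)
qed

text \<open>If \<open>f\<close> were nonzero, then for \<open>h = f \<star> star f\<close> some
  \<open>\<phi>\<close> in \<open>Z\<close>, obtained below a spectral idempotent of
  \<open>h\<close>, would satisfy \<open>(h \<star> h) \<star> \<phi> = L \<phi>\<close> with
  \<open>L > 0\<close>. But \<open>f \<star> \<phi> = inner f \<phi> * \<phi>\<close>
  vanishes.\<close>

lemma Z_complete:
  assumes f: "alg f" and orth: "\<And>\<phi>. \<phi> \<in> Z \<Longrightarrow> inner f \<phi> = 0"
  shows "f x = 0"
proof (rule ccontr)
  assume fx: "f x \<noteq> 0"
  note cf = alg_cont[OF f]
  define h where "h = f \<star> star f"
  have "f \<noteq> (\<lambda>x. 0)" using fx by auto
  then have "h e \<noteq> 0" using nrm2_pos[OF cf] by (simp add: h_def conv_star_unit inner_self)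
  then have h0: "h \<noteq> (\<lambda>x. 0)" by auto
  have ah: "alg h" unfolding h_def by (intro alg_intros f)
  have sh: "star h = h" by (simp add: h_def star_conv cf cont_star)
  obtain p0 L where p0: "L > 0" "idem p0" "(h \<star> h) \<star> p0 = (\<lambda>x. of_real L * p0 x)"
    by (rule spectral_idempotent[OF ah sh h0])
  obtain p where p: "idem p" "p0 \<star> p = p" "\<And>q. idem q \<Longrightarrow> p \<star> q = q \<Longrightarrow> q = p"
    by (rule minimal_idempotent[OF p0(2)]) (rule that)
  have c: "cont h" "cont p0" "cont p" using ah p0 p by (auto simp: idem_def alg_cont)
  have "(h \<star> h) \<star> p = ((h \<star> h) \<star> p0) \<star> p"
    using conv_assoc[OF cont_conv[OF c(1) c(1)] c(2,3)] by (simp add: p(2))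
  also have "\<dots> = (\<lambda>x. of_real L * p x)"
    by (simp add: p0(3) conv_scale_left p(2))
  finally have hp: "(h \<star> h) \<star> p = (\<lambda>x. of_real L * p x)" .
  define \<phi> where "\<phi> = (\<lambda>x. 1 / p e * p x)"
  have \<phi>: "\<phi> \<in> Z" using minimal_spherical[OF p(1,3)] by (simp add: \<phi>_def)
  have "h \<star> \<phi> = star f \<star> (f \<star> \<phi>)"
    unfolding h_def alg_comm[OF f alg_star[OF f]]
    by (intro conv_assoc cont_star cf Z_cont[OF \<phi>])
  also have "\<dots> = (\<lambda>x. 0)"
    by (simp add: conv_Z[OF \<phi> f] orth[OF \<phi>] convolution_def fun_eq_iff)
  finally have "h \<star> (h \<star> \<phi>) = (\<lambda>x. 0)" by (simp add: convolution_def fun_eq_iff)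
  then have "(h \<star> h) \<star> \<phi> = (\<lambda>x. 0)" by (simp add: conv_assoc c Z_cont[OF \<phi>])
  moreover have "(h \<star> h) \<star> \<phi> = (\<lambda>x. of_real L * \<phi> x)"
    unfolding \<phi>_def conv_scale_right hp by (simp add: mult_ac)
  ultimately have "of_real L * \<phi> e = 0" by metis
  then show False using p0(1) Z_unit[OF \<phi>] by simp
qed

section \<open>The dimension of the space spanned by the translates\<close>

definition orthonormal :: "('g \<Rightarrow> complex) set \<Rightarrow> bool" where
  "orthonormal E \<longleftrightarrow> finite E \<and> (\<forall>a\<in>E. cont a \<and> nrm2 a = 1) \<and>
     (\<forall>a\<in>E. \<forall>b\<in>E. a \<noteq> b \<longrightarrow> inner a b = 0)"

definition residual :: "('g \<Rightarrow> complex) set \<Rightarrow> ('g \<Rightarrow> complex) \<Rightarrow> 'g \<Rightarrow> complex" where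
  "residual E g x = g x - (\<Sum>a\<in>E. inner g a * a x)"

context
  fixes E assumes E: "orthonormal E"
begin

lemma orthonormal_cont: "a \<in> E \<Longrightarrow> cont a"
  using E by (simp add: orthonormal_def)

lemma orthonormal_inner: "a \<in> E \<Longrightarrow> b \<in> E \<Longrightarrow> inner a b = (if a = b then 1 else 0)"
  using E by (simp add: orthonormal_def inner_self)

lemma cont_residual: "cont g \<Longrightarrow> cont (residual E g)"
  unfolding residual_def[abs_def]
  by (intro cont_diff cont_sum cont_mult cont_const) (simp_all add: orthonormal_cont)

lemma inner_sum_basis:
  assumes b: "b \<in> E"
  shows "inner (\<lambda>x. \<Sum>a\<in>E. u a * a x) b = u b"
proof -
  have "inner (\<lambda>x. \<Sum>a\<in>E. u a * a x) b = (\<Sum>a\<in>E. u a * inner a b)"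
    by (subst inner_sum_left) (auto intro!: cont_mult cont_const simp: orthonormal_cont b inner_scale_left)
  also have "\<dots> = (\<Sum>a\<in>E. if a = b then u a else 0)"
    by (intro sum.cong refl) (simp add: orthonormal_inner b)
  also have "\<dots> = u b" using E b by (simp add: orthonormal_def)
  finally show ?thesis .
qed

lemma inner_residual:
  assumes g: "cont g" and b: "b \<in> E"
  shows "inner (residual E g) b = 0"
  unfolding residual_def[abs_def]
  by (subst inner_diff_left) (auto intro!: cont_sum cont_mult cont_const simp: orthonormal_cont g b inner_sum_basis)

lemma nrm2_residual:
  assumes g: "cont g"
  shows "nrm2 (residual E g) = nrm2 g - (\<Sum>a\<in>E. (norm (inner g a))\<^sup>2)"
proof -
  let ?s = "\<lambda>x. \<Sum>a\<in>E. inner g a * a x"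
  have s: "cont ?s" by (intro cont_sum cont_mult cont_const orthonormal_cont)
  have "inner (residual E g) ?s = 0"
    by (subst inner_sum_right)
      (auto intro!: cont_mult cont_const simp: orthonormal_cont cont_residual inner_scale_right inner_residual g)
  moreover have "inner (residual E g) (residual E g) = inner (residual E g) g - inner (residual E g) ?s"
    by (subst (2) residual_def[abs_def]) (intro inner_diff_right g s cont_residual)
  moreover have "inner (residual E g) g = inner g g - inner ?s g"
    by (subst residual_def[abs_def]) (intro inner_diff_left g s)
  moreover have "inner ?s g = of_real (\<Sum>a\<in>E. (norm (inner g a))\<^sup>2)"
    by (subst inner_sum_left)
      (auto intro!: cont_mult cont_const sum.cong
        simp: orthonormal_cont g inner_scale_left complex_norm_square inner_cnj[of _ g] simp del: of_real_power)
  ultimately have "complex_of_real (nrm2 (residual E g)) = of_real (nrm2 g - (\<Sum>a\<in>E. (norm (inner g a))\<^sup>2))"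
    by (simp add: inner_self)
  then show ?thesis by (simp only: of_real_eq_iff)
qed

end

lemma sum_fun_apply: "(\<Sum>a\<in>E. f a) x = (\<Sum>a\<in>E. f a x)" for f :: "'a \<Rightarrow> 'g \<Rightarrow> complex"
  by (induction E rule: infinite_finite_induct) auto

text \<open>Finite dimension is part of the conclusion: the diagonal of the reproducing kernel
  bounds every orthonormal family by \<open>1 / nrm2 \<phi>\<close>, so a largest family
  \<open>E\<close> exists. A nonzero residual of a translate could be normalised and added to it;
  hence \<open>E\<close> is a basis.\<close>

lemma delta_eq:
  assumes \<phi>: "\<phi> \<in> Z"
  shows "real (delta gm gi \<phi>) * nrm2 \<phi> = 1"
proof -
  interpret V: vector_space "\<lambda>(c::complex) (h::'g \<Rightarrow> complex) x. c * h x"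
    by unfold_locales (auto simp: fun_eq_iff algebra_simps)
  note c\<phi> = Z_cont[OF \<phi>]
  define c where "c = nrm2 \<phi>"
  have c: "c > 0" unfolding c_def by (rule Z_nrm2_pos[OF \<phi>])
  define t where "t x = (\<lambda>z. \<phi> (gi x \<cdot> z))" for x
  have delta: "delta gm gi \<phi> = V.dim (range t)"
    unfolding delta_def t_def by (rule arg_cong[of _ _ V.dim]) auto
  have ct: "cont (t x)" for x unfolding t_def by (intro cont_intros c\<phi>)
  have t_conv: "t x \<star> \<phi> = (\<lambda>z. of_real c * t x z)" for x
  proof
    fix z
    have "(t x \<star> \<phi>) z = (LINT y|\<omega>. \<phi> (gi x \<cdot> y) * \<phi> (gi (gi x \<cdot> y) \<cdot> (gi x \<cdot> z)))"
      by (simp add: convolution_def t_def assoc)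
    also have "\<dots> = (LINT y|\<omega>. \<phi> y * \<phi> (gi y \<cdot> (gi x \<cdot> z)))"
      by (rule haar_left) (intro continuous_intros cont_compose[OF c\<phi>])
    also have "\<dots> = (\<phi> \<star> \<phi>) (gi x \<cdot> z)" by (simp add: convolution_def)
    finally show "(t x \<star> \<phi>) z = of_real c * t x z"
      by (simp add: Z_conv_self[OF \<phi>] c_def t_def)
  qed
  have span: "cont h \<and> h \<star> \<phi> = (\<lambda>z. of_real c * h z)" if "h \<in> V.span (range t)" for h
    using that
  proof (induction rule: V.span_induct_alt)
    case base
    show ?case by (simp add: zero_fun_def cont_const conv_zero_left)
  next
    case (step r a h)
    then have a: "cont a" "a \<star> \<phi> = (\<lambda>z. of_real c * a z)" using ct t_conv by auto
    have h: "cont h" "h \<star> \<phi> = (\<lambda>z. of_real c * h z)" using step by auto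
    have ra: "cont (\<lambda>x. r * a x)" by (intro cont_mult cont_const a)
    have eq: "(\<lambda>x. r * a x) + h = (\<lambda>x. r * a x + h x)" by (simp add: fun_eq_iff)
    show ?case
      unfolding eq conv_add_left[OF ra h(1) c\<phi>] conv_scale_left a(2) h(2)
      using cont_add[OF ra h(1)] by (simp add: distrib_left mult.left_commute)
  qed
  text \<open>The space is a reproducing kernel space with kernel \<open>(x, z) \<mapsto> \<phi> (z\<^sup>-\<^sup>1 x) / c\<close>,
    whose diagonal is constantly \<open>1 / c\<close>.\<close>
  have reproducing: "inner h (t x) = of_real c * h x" if "h \<in> V.span (range t)" for h x
    using span[OF that] conv_eq_inner[of h \<phi> x] by (simp add: Z_star[OF \<phi>] t_def)
  have t_span: "t x \<in> V.span (range t)" for x by (intro V.span_base) simp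
  have nrm2_t: "nrm2 (t x) = c" for x
    using nrm2_left[OF c\<phi>, of "gi x"] by (simp add: t_def c_def)
  define P where "P E \<longleftrightarrow> orthonormal E \<and> E \<subseteq> V.span (range t)" for E
  have res_norm: "nrm2 (residual E (t x)) = c - c\<^sup>2 * (\<Sum>a\<in>E. (norm (a x))\<^sup>2)" if E: "P E" for E x
  proof -
    have "norm (inner (t x) a) = c * norm (a x)" if "a \<in> E" for a
    proof -
      have "a \<in> V.span (range t)" using that E by (auto simp: P_def)
      then have "inner (t x) a = cnj (of_real c * a x)"
        using inner_cnj[of "t x" a] by (simp add: reproducing)
      then show ?thesis using c by (simp add: norm_mult)
    qed
    then have "(\<Sum>a\<in>E. (norm (inner (t x) a))\<^sup>2) = c\<^sup>2 * (\<Sum>a\<in>E. (norm (a x))\<^sup>2)"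
      by (simp add: power_mult_distrib sum_distrib_left)
    then show ?thesis using nrm2_residual[of E "t x"] E ct by (simp add: P_def nrm2_t)
  qed
  have integral_card: "(LINT x|\<omega>. (\<Sum>a\<in>E. (norm (a x))\<^sup>2)) = real (card E)"
    and int_E: "integrable \<omega> (\<lambda>x. \<Sum>a\<in>E. (norm (a x))\<^sup>2)" if E: "P E" for E
  proof -
    have a: "integrable \<omega> (\<lambda>x. (norm (a x))\<^sup>2)" "(LINT x|\<omega>. (norm (a x))\<^sup>2) = 1" if "a \<in> E" for a
      using that E by (auto simp: P_def orthonormal_def nrm2_def
          intro!: integrable_real continuous_intros cont_compose)
    then show "integrable \<omega> (\<lambda>x. \<Sum>a\<in>E. (norm (a x))\<^sup>2)" by simp
    show "(LINT x|\<omega>. (\<Sum>a\<in>E. (norm (a x))\<^sup>2)) = real (card E)"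
      using a by (subst Bochner_Integration.integral_sum) simp_all
  qed
  have bound: "real (card E) \<le> 1 / c" if E: "P E" for E
  proof -
    have "(\<Sum>a\<in>E. (norm (a x))\<^sup>2) \<le> 1 / c" for x
    proof -
      have "c\<^sup>2 * (\<Sum>a\<in>E. (norm (a x))\<^sup>2) \<le> c"
        using nrm2_nonneg[of "residual E (t x)"] res_norm[OF E, of x] by simp
      then show ?thesis using c by (simp add: power2_eq_square field_simps)
    qed
    then have "(LINT x|\<omega>. (\<Sum>a\<in>E. (norm (a x))\<^sup>2)) \<le> (LINT x|\<omega>. 1 / c)"
      by (intro integral_mono int_E[OF E]) auto
    then show ?thesis by (simp add: integral_card[OF E] prob_space)
  qed
  have "P {}" by (simp add: P_def orthonormal_def)
  moreover have "\<forall>E. P E \<longrightarrow> card E < nat \<lceil>1 / c\<rceil> + 1"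
  proof (intro allI impI)
    fix E assume "P E"
    then have "real (card E) \<le> 1 / c" by (rule bound)
    then show "card E < nat \<lceil>1 / c\<rceil> + 1" by linarith
  qed
  ultimately obtain E where E: "P E" and max: "\<forall>E'. P E' \<longrightarrow> card E' \<le> card E"
    using ex_has_greatest_nat[of P "{}" card] by blast
  have onE: "orthonormal E" and E_span: "E \<subseteq> V.span (range t)" and finE: "finite E"
    using E by (auto simp: P_def orthonormal_def)
  have res_span: "residual E (t x) \<in> V.span (range t)" for x
  proof -
    have "(\<Sum>a\<in>E. (\<lambda>z. inner (t x) a * a z)) \<in> V.span (range t)"
      using E_span by (intro V.span_sum V.span_scale) auto
    moreover have "residual E (t x) = t x - (\<Sum>a\<in>E. (\<lambda>z. inner (t x) a * a z))"
      by (simp add: fun_eq_iff residual_def sum_fun_apply)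
    ultimately show ?thesis using t_span V.span_diff by simp
  qed
  have res0: "nrm2 (residual E (t x)) = 0" for x
  proof (rule ccontr)
    let ?r = "residual E (t x)"
    assume "nrm2 ?r \<noteq> 0"
    then have pos: "nrm2 ?r > 0" using nrm2_nonneg[of ?r] by simp
    have cr: "cont ?r" by (intro cont_residual onE ct)
    define d where "d = complex_of_real (1 / sqrt (nrm2 ?r))"
    define b where "b = (\<lambda>z. d * ?r z)"
    have cb: "cont b" unfolding b_def by (intro cont_intros cr)
    have nb: "nrm2 b = 1" using pos unfolding b_def nrm2_scale by (simp add: d_def norm_divide power_divide)
    have b_orth: "inner b a = 0" "inner a b = 0" if "a \<in> E" for a
      using inner_residual[OF onE ct that, of x] inner_cnj[of a b] by (simp_all add: b_def inner_scale_left)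
    have "b \<notin> E" using b_orth(1)[of b] nb by (auto simp: inner_self)
    moreover have "P (insert b E)"
      unfolding P_def
    proof
      show "orthonormal (insert b E)"
        using onE cb nb b_orth by (auto simp: orthonormal_def)
      show "insert b E \<subseteq> V.span (range t)"
        using E_span V.span_scale[OF res_span, of d x] by (simp add: b_def)
    qed
    ultimately have "card E + 1 \<le> card E" using max finE by force
    then show False by simp
  qed
  have "V.independent E"
    unfolding V.dependent_finite[OF finE]
  proof (intro notI, elim exE conjE bexE)
    fix u a assume a: "a \<in> E" "u a \<noteq> 0" and 0: "(\<Sum>v\<in>E. (\<lambda>x. u v * v x)) = 0"
    have "(\<Sum>v\<in>E. u v * v x) = 0" for x using fun_cong[OF 0, of x] by (simp add: sum_fun_apply)
    then have "inner (\<lambda>x. \<Sum>v\<in>E. u v * v x) a = 0" by (simp add: inner_def)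
    then show False using inner_sum_basis[OF onE a(1), of u] a(2) by simp
  qed
  moreover have "V.span E = V.span (range t)"
  proof (rule V.span_eq[THEN iffD2], intro conjI)
    show "E \<subseteq> V.span (range t)" by (rule E_span)
    show "range t \<subseteq> V.span E"
    proof
      fix g assume "g \<in> range t"
      then obtain x where g: "g = t x" by blast
      have "residual E (t x) z = 0" for z by (rule nrm2_eq_0[OF cont_residual[OF onE ct] res0])
      then have "g = (\<Sum>a\<in>E. (\<lambda>z. inner (t x) a * a z))"
        by (simp add: fun_eq_iff residual_def sum_fun_apply g)
      also have "\<dots> \<in> V.span E" by (intro V.span_sum V.span_scale V.span_base)
      finally show "g \<in> V.span E" .
    qed
  qed
  ultimately have dim: "delta gm gi \<phi> = card E"
    unfolding delta by (intro V.dim_eq_card)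
  \<comment> \<open>With zero residual Bessel's inequality is an equality at every \<open>x\<close>;
    integrating it counts \<open>E\<close>.\<close>
  have "(\<Sum>a\<in>E. (norm (a x))\<^sup>2) = 1 / c" for x
    using res_norm[OF E, of x] res0[of x] c by (simp add: power2_eq_square field_simps)
  then have "real (card E) = 1 / c"
    using integral_card[OF E] by (simp add: prob_space)
  then show ?thesis using c by (simp add: dim c_def)
qed

end

section \<open>Spherical expansions\<close>

lemma has_sum_finite_sum:
  fixes f :: "'i \<Rightarrow> 'a \<Rightarrow> complex"
  assumes "finite I" "\<And>i. i \<in> I \<Longrightarrow> (f i has_sum s i) S"
  shows "((\<lambda>x. \<Sum>i\<in>I. f i x) has_sum (\<Sum>i\<in>I. s i)) S"
  using assms by induction (simp_all add: has_sum_add has_sum_0)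

lemma pd_kernel_has_sum:
  assumes k: "\<And>\<phi>. \<phi> \<in> S \<Longrightarrow> pd_kernel (k \<phi>)" and sum: "\<And>p q. ((\<lambda>\<phi>. k \<phi> p q) has_sum f p q) S"
  shows "pd_kernel f"
  unfolding pd_kernel_def
proof (intro allI)
  fix n :: nat and y and c :: "nat \<Rightarrow> complex"
  have hs: "((\<lambda>\<phi>. \<Sum>j<n. \<Sum>l<n. k \<phi> (y j) (y l) * c j * cnj (c l))
      has_sum (\<Sum>j<n. \<Sum>l<n. f (y j) (y l) * c j * cnj (c l))) S"
    by (intro has_sum_finite_sum finite_lessThan has_sum_cmult_left sum)
  show "0 \<le> (\<Sum>j<n. \<Sum>l<n. f (y j) (y l) * c j * cnj (c l))"
    unfolding infsumI[OF hs, symmetric]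
  proof (rule infsum_nonneg_complex)
    show "(\<lambda>\<phi>. \<Sum>j<n. \<Sum>l<n. k \<phi> (y j) (y l) * c j * cnj (c l)) summable_on S"
      using hs by (rule has_sum_imp_summable)
    show "0 \<le> (\<Sum>j<n. \<Sum>l<n. k \<phi> (y j) (y l) * c j * cnj (c l))" if "\<phi> \<in> S" for \<phi>
      using k[OF that, unfolded pd_kernel_def, rule_format, where n=n and y=y and c=c] .
  qed
qed

context gelfand
begin

text \<open>Since \<open>norm (\<phi> x) \<le> 1\<close>, the bound \<open>M\<close> is a
  Weierstrass majorant: convergence along finite subsets of \<open>Z\<close> is uniform in
  \<open>x\<close>, which preserves continuity and allows termwise pairing with
  \<open>\<psi>\<close>.\<close>

lemma spherical_series:
  assumes sum: "\<And>x. ((\<lambda>\<phi>. b \<phi> * \<phi> x) has_sum g x) Z"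
    and dom: "\<And>\<phi>. \<phi> \<in> Z \<Longrightarrow> norm (b \<phi>) \<le> M \<phi>" "M summable_on Z"
  shows "alg g" and "\<psi> \<in> Z \<Longrightarrow> inner g \<psi> = b \<psi> * of_real (nrm2 \<psi>)"
proof -
  have "norm (b \<phi> * \<phi> x) \<le> M \<phi>" if "\<phi> \<in> Z" for \<phi> x
    using mult_mono[OF dom(1)[OF that] Z_norm_le[OF that, of x]] dom(1)[OF that]
    by (simp add: norm_mult order_trans[OF norm_ge_zero])
  then have unif: "uniform_limit UNIV (\<lambda>S x. \<Sum>\<phi>\<in>S. b \<phi> * \<phi> x) g (finite_subsets_at_top Z)"
    using sum dom(2) by (intro Weierstrass_m_test_general') auto
  have fin: "\<forall>\<^sub>F S in finite_subsets_at_top Z. finite S \<and> S \<subseteq> Z"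
    by (auto simp: eventually_finite_subsets_at_top intro: exI[of _ "{}"])
  have c: "cont (\<lambda>x. \<Sum>\<phi>\<in>S. b \<phi> * \<phi> x)" if "S \<subseteq> Z" for S
    using that by (intro cont_sum cont_mult cont_const) (auto intro: Z_cont)
  have cg: "cont g"
    unfolding cont_def
    by (rule uniform_limit_theorem[OF _ unif])
      (use c in \<open>auto simp: cont_def intro!: eventually_mono[OF fin]\<close>)
  have eq: "g x = g y" if "\<And>\<phi>. \<phi> \<in> Z \<Longrightarrow> \<phi> x = \<phi> y" for x y
  proof (rule has_sum_unique[OF sum])
    show "((\<lambda>\<phi>. b \<phi> * \<phi> x) has_sum g y) Z"
      using sum[of y] that has_sum_cong[of Z "\<lambda>\<phi>. b \<phi> * \<phi> x" "\<lambda>\<phi>. b \<phi> * \<phi> y"] by simp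
  qed
  show "alg g"
    by (rule algI[OF cg]) (auto intro!: eq simp: alg_left[OF Z_alg] alg_right[OF Z_alg])
  show "inner g \<psi> = b \<psi> * of_real (nrm2 \<psi>)" if \<psi>: "\<psi> \<in> Z"
  proof (rule eq_if_norm_diff_le)
    fix \<epsilon> :: real assume \<epsilon>: "\<epsilon> > 0"
    have "\<forall>\<^sub>F S in finite_subsets_at_top Z. \<forall>x. dist (\<Sum>\<phi>\<in>S. b \<phi> * \<phi> x) (g x) < \<epsilon>"
      using uniform_limitD[OF unif \<epsilon>] by simp
    then obtain S where S: "finite S" "S \<subseteq> Z"
        "\<forall>Y. finite Y \<and> S \<subseteq> Y \<and> Y \<subseteq> Z \<longrightarrow> (\<forall>x. dist (\<Sum>\<phi>\<in>Y. b \<phi> * \<phi> x) (g x) < \<epsilon>)"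
      unfolding eventually_finite_subsets_at_top by (elim exE conjE)
    \<comment> \<open>Adding \<open>\<psi>\<close> makes its term present in the partial sum, and
      every finite superset of \<open>S\<close> in \<open>Z\<close> is still within
      \<open>\<epsilon>\<close>.\<close>
    let ?Y = "insert \<psi> S" and ?s = "\<lambda>x. \<Sum>\<phi>\<in>insert \<psi> S. b \<phi> * \<phi> x"
    have Y: "finite ?Y" "?Y \<subseteq> Z" using S \<psi> by auto
    have "inner ?s \<psi> = (\<Sum>\<phi>\<in>?Y. b \<phi> * inner \<phi> \<psi>)"
      by (subst inner_sum_left)
        (use subsetD[OF Y(2)] in \<open>simp_all add: cont_mult cont_const Z_cont \<psi> inner_scale_left del: insert_iff\<close>)
    also have "\<dots> = (\<Sum>\<phi>\<in>?Y. if \<phi> = \<psi> then b \<psi> * of_real (nrm2 \<psi>) else 0)"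
      using Y(2) by (intro sum.cong refl) (auto simp: Z_orthogonal[OF _ \<psi>] inner_self)
    also have "\<dots> = b \<psi> * of_real (nrm2 \<psi>)" using Y(1) by simp
    finally have s: "inner ?s \<psi> = b \<psi> * of_real (nrm2 \<psi>)" .
    have "norm (inner g \<psi> - inner ?s \<psi>) \<le> \<epsilon>"
      unfolding inner_def
    proof (rule norm_integral_diff_le[OF borel_prob])
      show "integrable \<omega> (\<lambda>x. g x * cnj (\<psi> x))" "integrable \<omega> (\<lambda>x. ?s x * cnj (\<psi> x))"
        by (intro integrable_cont' cont_mult cont_cnj cg Z_cont[OF \<psi>] c[OF Y(2)])+
      show "norm (g x * cnj (\<psi> x) - ?s x * cnj (\<psi> x)) \<le> \<epsilon>" for x
      proof -
        have "norm (g x - ?s x) \<le> \<epsilon>"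
          using S(3)[rule_format, of ?Y x] Y by (simp add: dist_norm norm_minus_commute less_imp_le subset_insertI)
        then have "norm (g x - ?s x) * norm (\<psi> x) \<le> \<epsilon> * 1"
          using \<epsilon> by (intro mult_mono Z_norm_le[OF \<psi>]) auto
        then show ?thesis by (simp add: norm_mult flip: left_diff_distrib)
      qed
    qed
    then show "norm (inner g \<psi> - b \<psi> * of_real (nrm2 \<psi>)) \<le> 1 * \<epsilon>" by (simp add: s)
  qed simp
qed

lemma series_dominated:
  assumes "series_rep Z B f"
  shows "\<phi> \<in> Z \<Longrightarrow> norm (B \<phi> u v) \<le> (Re (B \<phi> u u) + Re (B \<phi> v v)) / 2"
    and "(\<lambda>\<phi>. (Re (B \<phi> u u) + Re (B \<phi> v v)) / 2) summable_on Z"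
proof -
  have "(\<lambda>\<phi>. Re (B \<phi> u u)) summable_on Z" for u
    using assms by (intro summable_on_Re) (simp add: series_rep_def)
  then show "(\<lambda>\<phi>. (Re (B \<phi> u u) + Re (B \<phi> v v)) / 2) summable_on Z"
    using summable_on_cmult_left[OF summable_on_add, of "\<lambda>\<phi>. Re (B \<phi> u u)" Z "\<lambda>\<phi>. Re (B \<phi> v v)" "1 / 2"]
    by simp
  show "norm (B \<phi> u v) \<le> (Re (B \<phi> u u) + Re (B \<phi> v v)) / 2" if "\<phi> \<in> Z"
    using assms that by (intro pd_kernel_norm_le) (simp add: series_rep_def)
qed

lemma series_rep_coefficient:
  assumes "series_rep Z B f" "\<phi> \<in> Z"
  shows "inner (\<lambda>x. f x u v) \<phi> = B \<phi> u v * of_real (nrm2 \<phi>)"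
  using spherical_series(2)[OF _ series_dominated[OF assms(1)] assms(2)] assms(1)
  by (simp add: series_rep_def)

text \<open>Each \<open>\<phi>\<close> is a positive multiple of
  \<open>\<phi> \<star> star \<phi>\<close>, which brings every term of the series under
  \<open>pd_kernel_times_conv_star\<close>.\<close>

lemma series_rep_P_sharp:
  assumes B: "series_rep Z B f"
  shows "f \<in> P_sharp gm gi K"
proof -
  have sum: "((\<lambda>\<phi>. B \<phi> u v * \<phi> x) has_sum f x u v) Z" for x u v
    using B by (simp add: series_rep_def)
  have alg: "alg (\<lambda>x. f x u v)" for u v
    by (rule spherical_series(1)[OF sum series_dominated[OF B]])
  have pd: "pd_kernel (\<lambda>p q. B \<phi> (snd p) (snd q) * \<phi> (gi (fst p) \<cdot> fst q))" if \<phi>: "\<phi> \<in> Z" for \<phi>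
  proof -
    have "pd_kernel (\<lambda>p q. of_real (1 / nrm2 \<phi>) *
        (B \<phi> (snd p) (snd q) * (\<phi> \<star> star \<phi>) (gi (fst p) \<cdot> fst q)))"
      using B \<phi> Z_nrm2_pos[OF \<phi>] Z_cont[OF \<phi>]
      by (intro pd_kernel_scale pd_kernel_times_conv_star) (simp_all add: series_rep_def)
    then show ?thesis using Z_nrm2_pos[OF \<phi>] by (simp add: Z_star[OF \<phi>] Z_conv_self[OF \<phi>])
  qed
  have "pd_kernel (\<lambda>p q. f (gi (fst p) \<cdot> fst q) (snd p) (snd q))"
    by (rule pd_kernel_has_sum[OF pd sum])
  then show ?thesis
    using alg by (simp add: P_sharp_def alg_def cont_def case_prod_beta')
qed

text \<open>Turns the integrated form of positive definiteness into a pairing with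
  \<open>star a \<star> b\<close>, which is again known when \<open>a\<close> and \<open>b\<close>
  are one spherical function or one idempotent.\<close>

lemma double_integral_eq_inner:
  assumes F: "cont F" and a: "cont a" and b: "cont b"
  shows "(LINT x|\<omega>. LINT y|\<omega>. F (gi x \<cdot> y) * a x * cnj (b y)) = inner F (star a \<star> b)"
proof -
  note cc = cont_compose[OF F] cont_compose[OF a] cont_compose[OF b]
  have "(LINT x|\<omega>. LINT y|\<omega>. F (gi x \<cdot> y) * a x * cnj (b y))
      = (LINT x|\<omega>. LINT y|\<omega>. F y * (a x * cnj (b (x \<cdot> y))))"
  proof (rule Bochner_Integration.integral_cong[OF refl])
    fix x
    have "(LINT y|\<omega>. F (gi x \<cdot> y) * (a x * cnj (b (x \<cdot> (gi x \<cdot> y)))))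
        = (LINT y|\<omega>. F y * (a x * cnj (b (x \<cdot> y))))"
      by (rule haar_left) (intro continuous_intros cc)
    then show "(LINT y|\<omega>. F (gi x \<cdot> y) * a x * cnj (b y)) = (LINT y|\<omega>. F y * (a x * cnj (b (x \<cdot> y))))"
      by (simp add: mult.assoc)
  qed
  also have "\<dots> = (LINT y|\<omega>. LINT x|\<omega>. F y * (a x * cnj (b (x \<cdot> y))))"
    by (intro fubini[OF borel_prob borel_prob] continuous_intros cc)
  also have "\<dots> = inner F (star a \<star> b)"
    unfolding inner_def
  proof (rule Bochner_Integration.integral_cong[OF refl])
    fix y
    have "(LINT x|\<omega>. a (gi x) * cnj (b (gi x \<cdot> y))) = (LINT x|\<omega>. a x * cnj (b (x \<cdot> y)))"
      by (rule haar_inv[of "\<lambda>x. a x * cnj (b (x \<cdot> y))"]) (intro continuous_intros cc)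
    moreover have "cnj ((star a \<star> b) y) = (LINT x|\<omega>. a (gi x) * cnj (b (gi x \<cdot> y)))"
      by (simp add: convolution_def star_def flip: Bochner_Integration.integral_cnj)
    ultimately show "(LINT x|\<omega>. F y * (a x * cnj (b (x \<cdot> y)))) = F y * cnj ((star a \<star> b) y)"
      by simp
  qed
  finally show ?thesis .
qed

section \<open>Fourier coefficients of a positive definite function\<close>

context
  fixes f :: "'g \<Rightarrow> 'x \<Rightarrow> 'x \<Rightarrow> complex"
  assumes f: "f \<in> P_sharp gm gi K"
begin

lemma P_sharp_alg: "alg (\<lambda>x. f x u v)"
  using f by (simp add: P_sharp_def alg_def cont_def)

lemmas P_sharp_cont = alg_cont[OF P_sharp_alg]

lemma P_sharp_pd: "pd_kernel (\<lambda>p q. f (gi (fst p) \<cdot> fst q) (snd p) (snd q))"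
  using f by (simp add: P_sharp_def case_prod_beta')

lemma P_sharp_integral:
  fixes M :: "nat \<Rightarrow> 'g measure"
  assumes "\<And>j. borel_prob (M j)" "\<And>j. cont (a j)"
  shows "(\<Sum>j<n. \<Sum>l<n. LINT x|M j. LINT y|M l. f (gi x \<cdot> y) (u j) (u l) * a j x * cnj (a l y)) \<ge> 0"
proof -
  have "continuous_on UNIV (\<lambda>p. f (gi (fst p) \<cdot> snd p) u v)" for u v
    by (intro cont_compose[OF P_sharp_cont] continuous_intros)
  then show ?thesis
    using pd_kernel_integral[OF compact_UNIV P_sharp_pd, where M=M and a=a and n=n and u=u] assms by (simp add: cont_def)
qed

definition coeff :: "('g \<Rightarrow> complex) \<Rightarrow> 'x \<Rightarrow> 'x \<Rightarrow> complex" where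
  "coeff \<phi> u v = inner (\<lambda>x. f x u v) \<phi> / of_real (nrm2 \<phi>)"

text \<open>Test with the functions \<open>c j * \<phi>\<close>: since
  \<open>\<phi> \<star> \<phi>\<close> is \<open>nrm2 \<phi>\<close> times \<open>\<phi>\<close>,
  each entry is the wanted one times the square of \<open>nrm2 \<phi>\<close>.\<close>

lemma coeff_pd:
  assumes \<phi>: "\<phi> \<in> Z"
  shows "pd_kernel (coeff \<phi>)"
  unfolding pd_kernel_def
proof (intro allI)
  fix n :: nat and u :: "nat \<Rightarrow> 'x" and c :: "nat \<Rightarrow> complex"
  let ?N = "nrm2 \<phi>"
  note pos = Z_nrm2_pos[OF \<phi>] and cont = Z_cont[OF \<phi>]
  have "(LINT x|\<omega>. LINT y|\<omega>. f (gi x \<cdot> y) (u j) (u l) * (c j * \<phi> x) * cnj (c l * \<phi> y))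
      = of_real (?N\<^sup>2) * (coeff \<phi> (u j) (u l) * c j * cnj (c l))" for j l
  proof -
    have "(LINT x|\<omega>. LINT y|\<omega>. f (gi x \<cdot> y) (u j) (u l) * (c j * \<phi> x) * cnj (c l * \<phi> y))
        = (LINT x|\<omega>. LINT y|\<omega>. c j * cnj (c l) * (f (gi x \<cdot> y) (u j) (u l) * \<phi> x * cnj (\<phi> y)))"
      by (simp add: mult_ac)
    also have "\<dots> = c j * cnj (c l) * inner (\<lambda>x. f x (u j) (u l)) (star \<phi> \<star> \<phi>)"
      using double_integral_eq_inner[OF P_sharp_cont cont cont] by simp
    also have "\<dots> = of_real (?N\<^sup>2) * (coeff \<phi> (u j) (u l) * c j * cnj (c l))"
      using pos by (simp add: Z_star[OF \<phi>] Z_conv_self[OF \<phi>] inner_scale_right coeff_def power2_eq_square)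
    finally show ?thesis .
  qed
  moreover have "(\<Sum>j<n. \<Sum>l<n. LINT x|\<omega>. LINT y|\<omega>.
      f (gi x \<cdot> y) (u j) (u l) * (c j * \<phi> x) * cnj (c l * \<phi> y)) \<ge> 0"
    using P_sharp_integral[of "\<lambda>_. \<omega>" "\<lambda>j x. c j * \<phi> x" u n] borel_prob cont_mult[OF cont_const cont]
    by simp
  ultimately have "of_real (?N\<^sup>2) * (\<Sum>j<n. \<Sum>l<n. coeff \<phi> (u j) (u l) * c j * cnj (c l)) \<ge> 0"
    by (simp add: sum_distrib_left)
  then show "(\<Sum>j<n. \<Sum>l<n. coeff \<phi> (u j) (u l) * c j * cnj (c l)) \<ge> 0"
    using pos by (simp add: less_eq_complex_def zero_le_mult_iff flip: of_real_power)
qed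

text \<open>Bessel's inequality: positive definiteness is tested against the measure
  \<open>\<delta>\<^sub>e - q \<omega>\<close>, where the idempotent \<open>q\<close> is the sum of the normalised spherical
  functions in \<open>S\<close>.\<close>

lemma coeff_sum_le:
  assumes S: "finite S" "S \<subseteq> Z"
  shows "(\<Sum>\<phi>\<in>S. Re (coeff \<phi> u u)) \<le> Re (f e u u)"
proof -
  let ?F = "\<lambda>x. f x u u"
  note Z = subsetD[OF S(2)]
  define r where "r \<phi> = complex_of_real (1 / nrm2 \<phi>)" for \<phi>
  have r: "cnj (r \<phi>) = r \<phi>" "\<phi> \<in> S \<Longrightarrow> r \<phi> * of_real (nrm2 \<phi>) = 1" for \<phi>
    using Z_nrm2_pos[OF Z] by (force simp: r_def)+
  define q where "q = (\<lambda>x. \<Sum>\<phi>\<in>S. r \<phi> * \<phi> x)"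
  have aq: "alg q" unfolding q_def by (intro alg_sum alg_scale Z_alg Z)
  note cq = alg_cont[OF aq] and cF = P_sharp_cont
  have sq: "star q = q"
    unfolding q_def star_def
  proof
    fix x
    have "cnj (r \<phi> * \<phi> (gi x)) = r \<phi> * \<phi> x" if "\<phi> \<in> S" for \<phi>
      using fun_cong[OF Z_star[OF Z[OF that]], of x] by (simp add: star_def r)
    then show "cnj (\<Sum>\<phi>\<in>S. r \<phi> * \<phi> (gi x)) = (\<Sum>\<phi>\<in>S. r \<phi> * \<phi> x)"
      by (simp only: cnj_sum) (rule sum.cong, auto)
  qed
  have "inner q \<phi> = 1" if \<phi>: "\<phi> \<in> S" for \<phi>
  proof -
    have "inner q \<phi> = (\<Sum>\<psi>\<in>S. r \<psi> * inner \<psi> \<phi>)"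
      unfolding q_def by (subst inner_sum_left)
        (simp_all add: cont_mult cont_const Z_cont Z \<phi> inner_scale_left)
    also have "\<dots> = (\<Sum>\<psi>\<in>S. if \<psi> = \<phi> then 1 else 0)"
      using Z_orthogonal[OF Z Z[OF \<phi>]]
      by (intro sum.cong refl) (auto simp: inner_self r)
    also have "\<dots> = 1" using S(1) \<phi> by simp
    finally show ?thesis .
  qed
  then have "\<phi> \<star> q = \<phi>" if "\<phi> \<in> S" for \<phi>
    using conv_Z[OF Z[OF that] aq] alg_comm[OF aq Z_alg[OF Z[OF that]]] that by simp
  then have "(\<lambda>x. r \<phi> * \<phi> x) \<star> q = (\<lambda>x. r \<phi> * \<phi> x)" if "\<phi> \<in> S" for \<phi>
    using that by (simp add: conv_scale_left)
  moreover have "cont (\<lambda>x. r \<phi> * \<phi> x)" if "\<phi> \<in> S" for \<phi>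
    by (intro cont_mult cont_const Z_cont Z that)
  ultimately have qq: "q \<star> q = q"
    by (subst (1 3) q_def) (simp add: conv_sum_left cq)
  let ?M = "\<lambda>j::nat. if j = 0 then return borel e else \<omega>"
  let ?a = "\<lambda>(j::nat) x. if j = 0 then 1 else - q x"
  have a: "cont (?a j)" for j
    using cont_mult[OF cont_const[of "-1"] cq] by (cases "j = 0") (simp_all add: cont_const)
  have M: "borel_prob (?M j)" for j by (simp add: borel_prob borel_prob_return)
  have "(\<Sum>j<2. \<Sum>l<2. LINT x|?M j. LINT y|?M l. ?F (gi x \<cdot> y) * ?a j x * cnj (?a l y)) \<ge> 0"
    by (rule P_sharp_integral[where M="?M" and a="?a" and u="\<lambda>_. u", OF M a])
  moreover have dirac: "(LINT x|return borel e. g x) = g e" if "continuous_on UNIV g" for g :: "'g \<Rightarrow> complex"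
    using that by (intro integral_return borel_measurable_continuous_onI) simp_all
  have "(LINT x|return borel e. LINT y|return borel e. ?F (gi x \<cdot> y)) = ?F e"
  proof -
    have "(LINT y|return borel e. ?F (gi x \<cdot> y)) = ?F (gi x)" for x
      using dirac[of "\<lambda>y. ?F (gi x \<cdot> y)"] by (simp add: cont_compose[OF cF] continuous_intros)
    then show ?thesis using dirac[of "\<lambda>x. ?F (gi x)"] by (simp add: cont_compose[OF cF] continuous_intros)
  qed
  moreover have "(LINT x|return borel e. LINT y|\<omega>. ?F (gi x \<cdot> y) * cnj (q y)) = inner ?F q"
    using dirac[OF continuous_integral[OF borel_prob, of "\<lambda>x y. ?F (gi x \<cdot> y) * cnj (q y)"]]
    by (simp add: inner_def cont_compose[OF cF] cont_compose[OF cq] continuous_intros)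
  moreover have "(LINT x|\<omega>. LINT y|return borel e. ?F (gi x \<cdot> y) * q x) = inner ?F q"
  proof -
    have "(LINT y|return borel e. ?F (gi x \<cdot> y) * q x) = ?F (gi x) * cnj (q (gi x))" for x
      using dirac[of "\<lambda>y. ?F (gi x \<cdot> y) * q x"] fun_cong[OF sq, of x]
      by (simp add: star_def cont_compose[OF cF] continuous_intros)
    then show ?thesis
      using haar_inv[of "\<lambda>x. ?F x * cnj (q x)"]
      by (simp add: inner_def cont_compose[OF cF] cont_compose[OF cq] continuous_intros)
  qed
  moreover have "(LINT x|\<omega>. LINT y|\<omega>. ?F (gi x \<cdot> y) * q x * cnj (q y)) = inner ?F q"
    by (simp add: double_integral_eq_inner[OF cF cq cq] sq qq)
  \<comment> \<open>Both cross terms contribute \<open>- inner ?F q\<close>, and the last term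
    contributes \<open>+ inner ?F q\<close> because \<open>q\<close> is idempotent.\<close>
  ultimately have "?F e - inner ?F q \<ge> 0"
    by (simp add: numeral_2_eq_2)
  moreover have "inner ?F q = (\<Sum>\<phi>\<in>S. coeff \<phi> u u)"
    unfolding q_def coeff_def
    by (subst inner_sum_right) (simp_all add: cont_mult cont_const Z_cont Z cF inner_scale_right r, simp add: r_def)
  ultimately show ?thesis by (simp add: less_eq_complex_def)
qed

lemma P_sharp_series_rep: "series_rep Z coeff f"
proof -
  have pd: "pd_kernel (coeff \<phi>)" if "\<phi> \<in> Z" for \<phi> by (rule coeff_pd[OF that])
  have diag: "coeff \<phi> u u = of_real (Re (coeff \<phi> u u))" "Re (coeff \<phi> u u) \<ge> 0" if "\<phi> \<in> Z" for \<phi> u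
    using pd_kernel_diag[OF pd[OF that], of u] by (simp_all add: less_eq_complex_def complex_eq_iff)
  have sum_Re: "(\<lambda>\<phi>. Re (coeff \<phi> u u)) summable_on Z" for u
  proof (rule nonneg_bdd_above_summable_on)
    show "bdd_above (sum (\<lambda>\<phi>. Re (coeff \<phi> u u)) ` {F. F \<subseteq> Z \<and> finite F})"
      using coeff_sum_le by (intro bdd_aboveI2[of _ _ "Re (f e u u)"]) auto
  qed (use diag in auto)
  have "(\<lambda>\<phi>. complex_of_real (Re (coeff \<phi> u u))) summable_on Z" for u
    using sum_Re by (rule summable_on_of_real)
  then have sum_diag: "(\<lambda>\<phi>. coeff \<phi> u u) summable_on Z" for u
    using diag(1) by (metis (no_types, lifting) summable_on_cong)
  have "((\<lambda>\<phi>. coeff \<phi> u v * \<phi> x) has_sum f x u v) Z" for x u v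
  proof -
    define M where "M \<phi> = (Re (coeff \<phi> u u) + Re (coeff \<phi> v v)) / 2" for \<phi>
    have M: "M summable_on Z"
      using summable_on_cmult_left[OF summable_on_add[OF sum_Re[of u] sum_Re[of v]], where c="1 / 2"]
      by (simp add: M_def[abs_def])
    have le: "norm (coeff \<phi> u v) \<le> M \<phi>" if "\<phi> \<in> Z" for \<phi>
      unfolding M_def by (rule pd_kernel_norm_le[OF pd[OF that]])
    define g where "g y = (\<Sum>\<^sub>\<infinity>\<phi>\<in>Z. coeff \<phi> u v * \<phi> y)" for y
    have sum: "((\<lambda>\<phi>. coeff \<phi> u v * \<phi> y) has_sum g y) Z" for y
    proof -
      have term_le: "norm (coeff \<phi> u v * \<phi> y) \<le> M \<phi>" if "\<phi> \<in> Z" for \<phi>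
        using mult_mono[OF le[OF that] Z_norm_le[OF that, of y]] le[OF that]
        by (simp add: norm_mult order_trans[OF norm_ge_zero])
      have "(\<lambda>\<phi>. norm (coeff \<phi> u v * \<phi> y)) summable_on Z"
        by (rule summable_on_comparison_test[OF M term_le norm_ge_zero])
      then show ?thesis unfolding g_def by (rule has_sum_infsum[OF abs_summable_summable])
    qed
    have g: "alg g" by (rule spherical_series(1)[OF sum le M])
    have g_coeff: "inner g \<phi> = coeff \<phi> u v * of_real (nrm2 \<phi>)" if "\<phi> \<in> Z" for \<phi>
      using sum le M that by (rule spherical_series(2))
    have "inner (\<lambda>x. f x u v - g x) \<phi> = 0" if \<phi>: "\<phi> \<in> Z" for \<phi>
      using g_coeff[OF \<phi>] Z_nrm2_pos[OF \<phi>]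
      by (simp add: inner_diff_left P_sharp_cont alg_cont[OF g] Z_cont[OF \<phi>] coeff_def)
    then have "f x u v - g x = 0"
      by (rule Z_complete[OF alg_diff[OF P_sharp_alg g]])
    then show ?thesis using sum[of x] by simp
  qed
  then show ?thesis using pd sum_diag by (simp add: series_rep_def)
qed

end

end

theorem theorem8p2:
  fixes gm :: "'g::t2_space \<Rightarrow> 'g \<Rightarrow> 'g" and gi :: "'g \<Rightarrow> 'g" and e :: 'g
    and \<omega>G \<omega>K :: "'g measure" and K :: "'g set"
    and f :: "'g \<Rightarrow> 'x \<Rightarrow> 'x \<Rightarrow> complex"
  assumes "compact_group gm gi e"
    and "haar_measure gm \<omega>G"
    and "closed_subgroup gm gi e K"
    and "subgroup_haar_measure gm K \<omega>K"
    and "gelfand_pair gm gi \<omega>G K"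
  shows "(f \<in> P_sharp gm gi K \<longleftrightarrow>
            (\<exists>B. series_rep (pd_spherical gm gi e \<omega>K) B f)) \<and>
         (f \<in> P_sharp gm gi K \<longrightarrow>
            (\<forall>B. series_rep (pd_spherical gm gi e \<omega>K) B f \<longrightarrow>
               (\<forall>\<phi>\<in>pd_spherical gm gi e \<omega>K. \<forall>u v.
                  B \<phi> u v = of_nat (delta gm gi \<phi>) *
                    (LINT x|\<omega>G. f x u v * cnj (\<phi> x)))))"
proof -
  interpret gelfand gm gi e \<omega>G K \<omega>K
    using assms by unfold_locales
  have "B \<phi> u v = of_nat (delta gm gi \<phi>) * (LINT x|\<omega>G. f x u v * cnj (\<phi> x))"
    if B: "series_rep Z B f" and \<phi>: "\<phi> \<in> Z" for B \<phi> u v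
  proof -
    \<comment> \<open>Pairing with \<open>\<phi>\<close> recovers any representing \<open>B\<close>
      up to the factor \<open>nrm2 \<phi>\<close>, and \<open>delta_eq\<close> inverts this factor;
      so the coefficients are unique.\<close>
    have "complex_of_real (real (delta gm gi \<phi>) * nrm2 \<phi>) = 1"
      by (simp only: delta_eq[OF \<phi>] of_real_1)
    then have "B \<phi> u v = of_nat (delta gm gi \<phi>) * (B \<phi> u v * of_real (nrm2 \<phi>))"
      by (simp add: mult.left_commute)
    then show ?thesis
      using series_rep_coefficient[OF B \<phi>, of u v] by (simp add: inner_def)
  qed
  then show ?thesis
    unfolding Z_def[symmetric] by (intro conjI iffI allI impI ballI exI)
      (rule P_sharp_series_rep, assumption, elim exE, rule series_rep_P_sharp)
qed

end
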